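(* Hamiltonians of ZZXX form emulate a $Y\otimes Y$ interaction with penalty gap $\mathcal{O}(\epsilon^{-4})$ given one slack qubit. Precisely: let $n\ge2$, let $\alpha\in\mathbb{R}$, let $\mathcal{H}_{\rm else}$ be a Hamiltonian of ZZXX form on $n$ qubits, and let $$\mathcal{H}_{\rm targ}=\mathcal{H}_{\rm else}+\alpha\,Y_1Y_2 .$$ Then there are constants $\epsilon_0,C>0$ (depending on $\alpha$ and $\mathcal{H}_{\rm else}$) such that for every $0<\epsilon\le\epsilon_0$ there exist $\Delta$ with $0<\Delta\le C\epsilon^{-4}$ and a Hermitian operator $V$ on $n+1$ qubits (the $n$ original qubits and one slack qubit $w$) such that the gadget Hamiltonian $\widetilde{\mathcal{H}}=\Delta|1\rangle\langle1|_w+V$ is of ZZXX form on $n+1$ qubits and, for $j=1,\dots,2^n$, the $j$-th smallest eigenvalue of $\widetilde{\mathcal{H}}$ differs from the $j$-th smallest eigenvalue of $\mathcal{H}_{\rm targ}$ (eigenvalues counted with multiplicity) by at most $\epsilon$.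
   Context: $X_i,Y_i,Z_i$ denote the Pauli matrices acting on qubit $i$. A Hamiltonian on $m$ qubits is of ZZXX form if, up to adding a real multiple of the identity, it equals $$\sum_ih_iZ_i+\sum_i\Delta_iX_i+\sum_{i,j}J_{ij}Z_iZ_j+\sum_{i,j}K_{ij}X_iX_j$$ with real coefficients, the double sums being over pairs of distinct qubits. *)

theory Defs
  imports
    "Jordan_Normal_Form.Schur_Decomposition"
    "HOL-Computational_Algebra.Fundamental_Theorem_Algebra"
begin

text \<open>
  Operators on \<open>m\<close> qubits are matrices in \<open>carrier_mat (2 ^ m) (2 ^ m)\<close>. Qubits are numbered
  \<open>0, \<dots>, m - 1\<close>; qubit \<open>0\<close> is the leftmost tensor factor.
\<close>

definition kron :: "complex mat \<Rightarrow> complex mat \<Rightarrow> complex mat" where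
  "kron A B = mat (dim_row A * dim_row B) (dim_col A * dim_col B)
     (\<lambda>(r, c). A $$ (r div dim_row B, c div dim_col B) * B $$ (r mod dim_row B, c mod dim_col B))"

definition pauliX :: "complex mat" where
  "pauliX = mat_of_rows_list 2 [[0, 1], [1, 0]]"

definition pauliY :: "complex mat" where
  "pauliY = mat_of_rows_list 2 [[0, - \<i>], [\<i>, 0]]"

definition pauliZ :: "complex mat" where
  "pauliZ = mat_of_rows_list 2 [[1, 0], [0, -1]]"

definition ketbra1 :: "complex mat" where  \<comment> \<open>\<open>|1><1|\<close>\<close>
  "ketbra1 = mat_of_rows_list 2 [[0, 0], [0, 1]]"

text \<open>Meaningful only for \<open>i < m\<close> and a \<open>2 \<times> 2\<close> matrix \<open>P\<close>.\<close>

definition on_qubit :: "nat \<Rightarrow> complex mat \<Rightarrow> nat \<Rightarrow> complex mat" where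
  "on_qubit m P i = kron (kron (1\<^sub>m (2 ^ i)) P) (1\<^sub>m (2 ^ (m - 1 - i)))"

abbreviation X_on :: "nat \<Rightarrow> nat \<Rightarrow> complex mat" where
  "X_on m i \<equiv> on_qubit m pauliX i"

abbreviation Y_on :: "nat \<Rightarrow> nat \<Rightarrow> complex mat" where
  "Y_on m i \<equiv> on_qubit m pauliY i"

abbreviation Z_on :: "nat \<Rightarrow> nat \<Rightarrow> complex mat" where
  "Z_on m i \<equiv> on_qubit m pauliZ i"

text \<open>
  Matrices of unspecified dimension form no additive monoid type, so \<open>sum\<close> does not apply to
  them and the sum of a family of \<open>d \<times> d\<close> matrices is taken entrywise.
\<close>

definition mat_family_sum :: "nat \<Rightarrow> ('i \<Rightarrow> complex mat) \<Rightarrow> 'i set \<Rightarrow> complex mat" where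
  "mat_family_sum d F I = mat d d (\<lambda>rc. \<Sum>i\<in>I. F i $$ rc)"

definition qubit_pairs :: "nat \<Rightarrow> (nat \<times> nat) set" where
  "qubit_pairs m = {(i, j). i < j \<and> j < m}"

definition zzxx_form :: "nat \<Rightarrow> complex mat \<Rightarrow> bool" where
  "zzxx_form m H \<longleftrightarrow>
     (\<exists>(c :: real) (h :: nat \<Rightarrow> real) (D :: nat \<Rightarrow> real)
        (J :: nat \<Rightarrow> nat \<Rightarrow> real) (K :: nat \<Rightarrow> nat \<Rightarrow> real).
        H = complex_of_real c \<cdot>\<^sub>m 1\<^sub>m (2 ^ m)
          + mat_family_sum (2 ^ m) (\<lambda>i. complex_of_real (h i) \<cdot>\<^sub>m Z_on m i) {..<m}
          + mat_family_sum (2 ^ m) (\<lambda>i. complex_of_real (D i) \<cdot>\<^sub>m X_on m i) {..<m}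
          + mat_family_sum (2 ^ m)
              (\<lambda>(i, j). complex_of_real (J i j) \<cdot>\<^sub>m (Z_on m i * Z_on m j)) (qubit_pairs m)
          + mat_family_sum (2 ^ m)
              (\<lambda>(i, j). complex_of_real (K i j) \<cdot>\<^sub>m (X_on m i * X_on m j)) (qubit_pairs m))"

definition hermitian_mat :: "complex mat \<Rightarrow> bool" where
  "hermitian_mat A \<longleftrightarrow> mat_adjoint A = A"

text \<open>
  The eigenvalues of a Hermitian matrix are real and their algebraic and geometric
  multiplicities agree, so for Hermitian \<open>A\<close> this is the ascending list of all eigenvalues,
  each repeated according to its multiplicity; \<open>Re\<close> only changes the type.
\<close>

definition sorted_eigenvalues :: "complex mat \<Rightarrow> real list" where
  "sorted_eigenvalues A = sorted_list_of_multiset (image_mset Re (proots (char_poly A)))"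

definition nth_eigenvalue :: "nat \<Rightarrow> complex mat \<Rightarrow> real" where  \<comment> \<open>counted from \<open>j = 1\<close>\<close>
  "nth_eigenvalue j A = sorted_eigenvalues A ! (j - 1)"

lemma length_sorted_eigenvalues:
  assumes "A \<in> carrier_mat d d"
  shows "length (sorted_eigenvalues A) = d"
proof -
  have "length (sorted_eigenvalues A) = size (proots (char_poly A))"
    unfolding sorted_eigenvalues_def
    by (metis mset_sorted_list_of_multiset size_image_mset size_mset)
  then show ?thesis
    using degree_monic_char_poly[OF assms] by (simp add: size_proots_complex)
qed

end

theory Submission
  imports Defs
begin

text \<open>
  With the slack qubit as a block index, the gadget is the block matrix with rows
  \<open>(A, l R)\<close> and \<open>(l R, A + l\<^sup>2 D)\<close>, where \<open>D = 1 + (Z\<^sub>0 + Z\<^sub>1) / 4\<close>, \<open>R = r X\<^sub>0 + t X\<^sub>1\<close> and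
  \<open>A = H_targ + R D\<^sup>-\<^sup>1 R\<close>. Since \<open>D\<^sup>-\<^sup>1\<close> contains a \<open>Z\<^sub>0 Z\<^sub>1\<close> term and
  \<open>(X\<^sub>0 \<plusminus> X\<^sub>1) Z\<^sub>0 Z\<^sub>1 (X\<^sub>0 \<plusminus> X\<^sub>1) = - 2 Z\<^sub>0 Z\<^sub>1 \<plusminus> 2 Y\<^sub>0 Y\<^sub>1\<close>, the product \<open>R D\<^sup>-\<^sup>1 R\<close> produces a
  \<open>Y\<^sub>0 Y\<^sub>1\<close> interaction; \<open>r\<close> and \<open>t\<close> are chosen so that it cancels the one in \<open>H_targ\<close>, which leaves
  \<open>A\<close> of ZZXX form. The Schur complement of the slack block \<open>l\<^sup>2 D\<close> is exactly \<open>H_targ\<close>, and the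
  remaining part \<open>A\<close> of the slack block perturbs the low eigenvalues by \<open>O(l\<^sup>-\<^sup>2)\<close> only, because the
  vectors involved have a slack component of norm \<open>O(l\<^sup>-\<^sup>1)\<close>. Hence \<open>\<Delta> = l\<^sup>2\<close> of order \<open>\<epsilon>\<^sup>-\<^sup>1\<close>
  suffices.
\<close>

section \<open>Diagonalization of Hermitian matrices\<close>

text \<open>The real part makes the inner product symmetric and bilinear over the reals. Quadratic
  forms of Hermitian matrices are real, so \<open>rip (A *\<^sub>v v) v\<close> still is the usual
  Rayleigh numerator.\<close>

definition rip :: "complex vec \<Rightarrow> complex vec \<Rightarrow> real" where
  "rip x y = Re (x \<bullet>c y)"

lemma rip_sum:
  assumes "x \<in> carrier_vec d" "y \<in> carrier_vec d"
  shows "rip x y = (\<Sum>i<d. Re (x $ i * cnj (y $ i)))"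
  using assms by (auto simp: rip_def scalar_prod_def lessThan_atLeast0)

lemma rip_self_sum:
  assumes "x \<in> carrier_vec d"
  shows "rip x x = (\<Sum>i<d. (cmod (x $ i))\<^sup>2)"
   unfolding rip_sum[OF assms assms] by (intro sum.cong refl) (simp add: cmod_power2 flip: power2_eq_square)

lemma rip_commute:
  assumes "x \<in> carrier_vec d" "y \<in> carrier_vec d"
  shows "rip x y = rip y x"
  unfolding rip_sum[OF assms] rip_sum[OF assms(2,1)] by (intro sum.cong) auto

lemma rip_add_left:
  assumes "x \<in> carrier_vec d" "y \<in> carrier_vec d" "z \<in> carrier_vec d"
  shows "rip (x + y) z = rip x z + rip y z"
  using assms by (simp add: rip_sum[of _ d] sum.distrib algebra_simps)

lemma rip_add_right:
  assumes "x \<in> carrier_vec d" "y \<in> carrier_vec d" "z \<in> carrier_vec d"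
  shows "rip x (y + z) = rip x y + rip x z"
  using assms by (simp add: rip_sum[of _ d] sum.distrib algebra_simps)

lemma rip_smult_left:
  assumes "x \<in> carrier_vec d" "y \<in> carrier_vec d"
  shows "rip (complex_of_real c \<cdot>\<^sub>v x) y = c * rip x y"
  using assms by (simp add: rip_sum[of _ d] sum_distrib_left algebra_simps)

lemma rip_smult_right:
  assumes "x \<in> carrier_vec d" "y \<in> carrier_vec d"
  shows "rip x (complex_of_real c \<cdot>\<^sub>v y) = c * rip x y"
  using assms by (simp add: rip_sum[of _ d] sum_distrib_left algebra_simps)

lemma rip_nonneg: "0 \<le> rip x x"
  by (subst rip_self_sum[OF carrier_vec_dim_vec]) (simp add: sum_nonneg)

lemma rip_self_eq_0:
  assumes "x \<in> carrier_vec d"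
  shows "rip x x = 0 \<longleftrightarrow> x = 0\<^sub>v d"
proof
  assume "rip x x = 0"
  then have "\<forall>i<d. x $ i = 0"
    using rip_self_sum[OF assms] by (simp add: sum_nonneg_eq_0_iff)
  then show "x = 0\<^sub>v d" using assms by (intro eq_vecI) auto
qed (simp add: rip_sum[of _ d])

section \<open>Adjoints and entrywise formulas for products\<close>

lemma adjoint_dim [simp]:
  "dim_row (mat_adjoint A) = dim_col A" "dim_col (mat_adjoint A) = dim_row A"
  by (auto simp: mat_adjoint_def)

lemma adjoint_carrier [simp]: "A \<in> carrier_mat r c \<Longrightarrow> mat_adjoint A \<in> carrier_mat c r"
  by (rule carrier_matI) (simp_all only: adjoint_dim carrier_matD)

lemma adjoint_index [simp]:
  "i < dim_col A \<Longrightarrow> j < dim_row A \<Longrightarrow> mat_adjoint (A :: complex mat) $$ (i, j) = cnj (A $$ (j, i))"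
  by (auto simp: mat_adjoint_def mat_of_rows_def)

lemma mult_mat_vec_index:
  assumes "A \<in> carrier_mat r c" "x \<in> carrier_vec c" "i < r"
  shows "(A *\<^sub>v x) $ i = (\<Sum>j<c. A $$ (i, j) * x $ j)"
  using assms by (auto simp: scalar_prod_def lessThan_atLeast0)

lemma mult_mat_index:
  assumes "A \<in> carrier_mat r c" "B \<in> carrier_mat c d" "i < r" "j < d"
  shows "(A * B) $$ (i, j) = (\<Sum>k<c. A $$ (i, k) * B $$ (k, j))"
  using assms by (auto simp: scalar_prod_def lessThan_atLeast0)

lemma rip_adjoint:
  assumes "A \<in> carrier_mat r c" "x \<in> carrier_vec c" "y \<in> carrier_vec r"
  shows "rip (A *\<^sub>v x) y = rip x (mat_adjoint A *\<^sub>v y)"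
proof -
  have A': "mat_adjoint A \<in> carrier_mat c r" using assms by simp
  note Ax = mult_mat_vec_carrier[OF assms(1,2)] and A'y = mult_mat_vec_carrier[OF A' assms(3)]
  have "rip (A *\<^sub>v x) y = Re (\<Sum>i<r. \<Sum>j<c. A $$ (i, j) * x $ j * cnj (y $ i))"
    unfolding rip_sum[OF Ax assms(3)] Re_sum[symmetric]
    using assms
    by (simp add: mult_mat_vec_index[of _ r c] sum_distrib_right
        del: index_mult_mat_vec Re_sum times_complex.sel)
  also have "(\<Sum>i<r. \<Sum>j<c. A $$ (i, j) * x $ j * cnj (y $ i)) =
      (\<Sum>j<c. \<Sum>i<r. A $$ (i, j) * x $ j * cnj (y $ i))"
    by (rule sum.swap)
  also have "Re \<dots> = rip x (mat_adjoint A *\<^sub>v y)"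
    unfolding rip_sum[OF assms(2) A'y] Re_sum[symmetric]
    using assms
    by (simp add: mult_mat_vec_index[OF A'] sum_distrib_left ac_simps
        del: index_mult_mat_vec Re_sum times_complex.sel)
  finally show ?thesis .
qed

lemma rip_hermitian:
  assumes "A \<in> carrier_mat d d" "hermitian_mat A" "x \<in> carrier_vec d" "y \<in> carrier_vec d"
  shows "rip (A *\<^sub>v x) y = rip x (A *\<^sub>v y)"
  using rip_adjoint[OF assms(1,3,4)] assms(2) by (simp add: hermitian_mat_def)

lemma adjoint_mult:
  assumes "A \<in> carrier_mat r c" "B \<in> carrier_mat c d"
  shows "mat_adjoint (A * B) = mat_adjoint B * mat_adjoint (A :: complex mat)"
proof (rule eq_matI)
  have AB: "A * B \<in> carrier_mat r d" using assms by simp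
  fix i j assume "i < dim_row (mat_adjoint B * mat_adjoint A)" "j < dim_col (mat_adjoint B * mat_adjoint A)"
  then have i: "i < d" and j: "j < r" using assms by auto
  then show "mat_adjoint (A * B) $$ (i, j) = (mat_adjoint B * mat_adjoint A) $$ (i, j)"
    using assms AB
    by (simp add: mult_mat_index[OF assms j i] mult_mat_index[of _ d c _ r] del: index_mult_mat(1))
      (simp add: ac_simps)
qed (use assms in auto)

lemma adjoint_adjoint [simp]: "mat_adjoint (mat_adjoint A) = (A :: complex mat)"
  by (rule eq_matI) auto

lemma adjoint_one [simp]: "mat_adjoint (1\<^sub>m n) = (1\<^sub>m n :: complex mat)"
  by (rule eq_matI) auto

text \<open>Gram-Schmidt on a basis that begins with \<open>v\<close> leaves \<open>v\<close> in
  first place; dividing the resulting orthogonal vectors by their norms gives the columns of a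
  unitary matrix. The first column is thus a multiple of \<open>v\<close>.\<close>

lemma unitary_completion:
  fixes v :: "complex vec"
  assumes v: "v \<in> carrier_vec n" "v \<noteq> 0\<^sub>v n"
  shows "\<exists>W \<in> carrier_mat n n. mat_adjoint W * W = 1\<^sub>m n \<and> (\<exists>c. col W 0 = c \<cdot>\<^sub>v v)"
proof -
  interpret cof_vec_space n "TYPE(complex)" .
  define b where "b = basis_completion v"
  define ws where "ws = gram_schmidt n b"
  from basis_completion[OF v, folded b_def]
  have dist_b: "distinct b" and indep: "\<not> lin_dep (set b)" and b: "set b \<subseteq> carrier_vec n"
    and hdb: "hd b = v" and len_b: "length b = n" by auto
  have n: "n > 0" using v by (metis carrier_vecD eq_vecI gr0I index_zero_vec(2) not_less0)
  obtain vs where bv: "b = v # vs" using hdb len_b n by (cases b) auto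
  from gram_schmidt_result[OF b dist_b indep refl, folded ws_def]
  have ws: "set ws \<subseteq> carrier_vec n" "corthogonal ws" "length ws = n" by (auto simp: len_b)
  have hdws: "hd ws = v" unfolding ws_def bv using v by simp
  \<comment> \<open>The factor that normalizes the \<open>j\<close>-th orthogonal vector.\<close>
  define s where "s j = complex_of_real (1 / sqrt (rip (ws ! j) (ws ! j)))" for j
  define W where "W = mat n n (\<lambda>(i, j). s j * ws ! j $ i)"
  have W: "W \<in> carrier_mat n n" by (simp add: W_def)
  have wsc: "ws ! j \<in> carrier_vec n" if "j < n" for j using ws that by auto
  have "mat_adjoint W * W = 1\<^sub>m n"
  proof (rule eq_matI)
    fix i j assume "i < dim_row (1\<^sub>m n :: complex mat)" "j < dim_col (1\<^sub>m n :: complex mat)"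
    then have i: "i < n" and j: "j < n" by auto
    have "(mat_adjoint W * W) $$ (i, j) = (\<Sum>k<n. cnj (s i * ws ! i $ k) * (s j * ws ! j $ k))"
      using i j by (subst mult_mat_index[of _ n n _ n]) (auto simp: W_def)
    also have "\<dots> = s i * s j * (ws ! j \<bullet>c ws ! i)"
      using wsc[OF i] wsc[OF j]
      by (simp add: scalar_prod_def sum_distrib_left sum_divide_distrib lessThan_atLeast0 s_def ac_simps)
    also have "\<dots> = (if i = j then 1 else 0)"
    proof (cases "i = j")
      case True
      have "ws ! i \<bullet>c ws ! i \<noteq> 0" using corthogonalD[OF ws(2), of i i] ws(3) i by auto
      then have "ws ! i \<noteq> 0\<^sub>v n" using wsc[OF i] conjugate_square_eq_0_vec by auto
      then have "rip (ws ! i) (ws ! i) > 0"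
        using rip_self_eq_0[OF wsc[OF i]] rip_nonneg[of "ws ! i"] by linarith
      moreover have "ws ! i \<bullet>c ws ! i = complex_of_real (rip (ws ! i) (ws ! i))"
        using conjugate_square_ge_0_vec[of "ws ! i"] by (simp add: rip_def complex_eq_iff less_eq_complex_def)
      ultimately show ?thesis
        using True by (simp add: s_def flip: of_real_mult)
    next
      case False
      then show ?thesis using corthogonalD[OF ws(2), of j i] ws(3) i j by auto
    qed
    finally show "(mat_adjoint W * W) $$ (i, j) = 1\<^sub>m n $$ (i, j)" using i j by simp
  qed (use W in auto)
  moreover have "ws ! 0 = v" using n hdws ws(3) by (metis hd_conv_nth list.size(3) less_irrefl)
  moreover from this have "col W 0 = s 0 \<cdot>\<^sub>v v"
    using n v by (intro eq_vecI) (auto simp: W_def)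
  ultimately show ?thesis using W by blast
qed

lemma adjoint_four_block:
  assumes "A \<in> carrier_mat r1 c1" "D \<in> carrier_mat r2 c2"
  shows "mat_adjoint (four_block_mat A (0\<^sub>m r1 c2) (0\<^sub>m r2 c1) D) =
    four_block_mat (mat_adjoint A) (0\<^sub>m c1 r2) (0\<^sub>m c2 r1) (mat_adjoint (D :: complex mat))"
  using assms by (intro eq_matI) auto

text \<open>Deflation: a unitary whose first column is an eigenvector for the first listed root
  splits off a block of size one, and the induction hypothesis diagonalizes the rest. The diagonal
  follows the order of \<open>es\<close>, so the caller decides how the eigenvalues are
  arranged.\<close>

lemma hermitian_diagonalization:
  assumes "A \<in> carrier_mat n n" "hermitian_mat A"
    and "char_poly A = (\<Prod>e\<leftarrow>es. [:- e, 1:])"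
  shows "\<exists>U \<in> carrier_mat n n. mat_adjoint U * U = 1\<^sub>m n \<and>
    A * U = U * mat n n (\<lambda>(i, j). if i = j then es ! i else 0)"
  using assms
proof (induct es arbitrary: n A)
  case Nil
  with degree_monic_char_poly[of A n] have "n = 0" by simp
  then show ?case using Nil by (intro bexI[of _ "1\<^sub>m 0"]) auto
next
  case (Cons e es n A)
  let ?m = "n - 1"
  from Cons have A: "A \<in> carrier_mat n n" and HA: "mat_adjoint A = A"
    by (auto simp: hermitian_mat_def)
  let ?cp = "char_poly A"
  from Cons have cp: "?cp = [: -e, 1 :] * (\<Prod>e \<leftarrow> es. [:- e, 1:])" by auto
  have ev: "eigenvalue A e"
    unfolding eigenvalue_root_char_poly[OF A] cp by simp
  then obtain v where v: "v \<in> carrier_vec n" "v \<noteq> 0\<^sub>v n" and Av: "A *\<^sub>v v = e \<cdot>\<^sub>v v"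
    using A by (auto simp: eigenvalue_def eigenvector_def)
  have n: "n > 0" using v by (metis carrier_vecD eq_vecI gr0I index_zero_vec(2) not_less0)
  obtain W c where W: "W \<in> carrier_mat n n" and WW: "mat_adjoint W * W = 1\<^sub>m n"
    and col: "col W 0 = c \<cdot>\<^sub>v v" using unitary_completion[OF v] by blast
  let ?W' = "mat_adjoint W"
  have W': "?W' \<in> carrier_mat n n" using W by simp
  have WW': "W * ?W' = 1\<^sub>m n" using mat_mult_left_right_inverse[OF W' W WW] .
  define A' where "A' = ?W' * A * W"
  have W'A: "?W' * A \<in> carrier_mat n n" using mult_carrier_mat[OF W' A] .
  have AWc: "A * W \<in> carrier_mat n n" using mult_carrier_mat[OF A W] .
  have A': "A' \<in> carrier_mat n n" unfolding A'_def using mult_carrier_mat[OF W'A W] .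
  have HA': "mat_adjoint A' = A'"
    unfolding A'_def adjoint_mult[OF W'A W] adjoint_mult[OF W' A] HA adjoint_adjoint
    using assoc_mult_mat[OF W' A W] by simp
  have sim: "similar_mat A' A"
    unfolding similar_mat_def
    using similar_mat_witI[OF WW WW' A'_def A' A W' W] by blast
  \<comment> \<open>Conjugation by \<open>W\<close> turns the eigenvector into the first unit
    vector.\<close>
  have col0: "col A' 0 = e \<cdot>\<^sub>v unit_vec n 0"
  proof -
    have "col A' 0 = ?W' *\<^sub>v (A *\<^sub>v col W 0)"
      unfolding A'_def assoc_mult_mat[OF W' A W] col_mult2[OF W' AWc n] col_mult2[OF A W n] ..
    also have "A *\<^sub>v col W 0 = e \<cdot>\<^sub>v col W 0"
      unfolding col using A v by (simp add: mult_mat_vec[OF A] Av smult_smult_assoc mult.commute)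
    also have "?W' *\<^sub>v (e \<cdot>\<^sub>v col W 0) = e \<cdot>\<^sub>v (?W' *\<^sub>v col W 0)"
      using W W' n by (simp add: mult_mat_vec[OF W'])
    also have "?W' *\<^sub>v col W 0 = col (?W' * W) 0" by (rule col_mult2[OF W' W n, symmetric])
    also have "\<dots> = unit_vec n 0" unfolding WW using n by simp
    finally show ?thesis .
  qed
  have A'0: "A' $$ (i, 0) = (if i = 0 then e else 0)" if "i < n" for i
    using arg_cong[OF col0, of "\<lambda>v. v $ i"] that A' n by auto
  \<comment> \<open>Hermiticity transfers the zeros of the first column to the first row, which
    makes \<open>A'\<close> block diagonal.\<close>
  have A'0': "A' $$ (0, i) = (if i = 0 then cnj e else 0)" if "i < n" for i
    using A'0[OF that] that A' n arg_cong[OF HA', of "\<lambda>M. M $$ (0, i)"] by auto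
  define B where "B = mat ?m ?m (\<lambda>(i, j). A' $$ (Suc i, Suc j))"
  have B: "B \<in> carrier_mat ?m ?m" by (simp add: B_def)
  define E where "E = mat 1 1 (\<lambda>_. e)"
  have E: "E \<in> carrier_mat 1 1" by (simp add: E_def)
  have A'_block: "A' = four_block_mat E (0\<^sub>m 1 ?m) (0\<^sub>m ?m 1) B"
    using A' n A'0 A'0' A'0[of 0] A'0'[of 0]
    by (intro eq_matI) (auto simp: B_def E_def)
  have "hermitian_mat B"
    unfolding hermitian_mat_def
  proof (rule eq_matI)
    fix i j assume "i < dim_row B" "j < dim_col B"
    then have "i < ?m" "j < ?m" using B by auto
    then show "mat_adjoint B $$ (i, j) = B $$ (i, j)"
      using arg_cong[OF HA', of "\<lambda>M. M $$ (Suc i, Suc j)"] A' by (auto simp: B_def)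
  qed (use B in auto)
  \<comment> \<open>The linear factor of the split-off eigenvalue cancels, which leaves the
    remaining roots for \<open>B\<close>.\<close>
  moreover have "char_poly B = (\<Prod>e\<leftarrow>es. [:- e, 1:])"
  proof -
    have "[: -e, 1 :] * (\<Prod>e \<leftarrow> es. [:- e, 1:]) = char_poly A'"
      using char_poly_similar[OF sim] cp by simp
    also have "\<dots> = char_poly E * char_poly B"
      unfolding A'_block by (rule char_poly_four_block_zeros_col) (use B E in auto)
    also have "char_poly E = [: -e,1 :]"
      by (simp add: E_def char_poly_defs det_def sign_def)
    finally show ?thesis by (metis mult_cancel_left pCons_eq_0_iff zero_neq_one)
  qed
  ultimately obtain P where P: "P \<in> carrier_mat ?m ?m" and PP: "mat_adjoint P * P = 1\<^sub>m ?m"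
    and BP: "B * P = P * mat ?m ?m (\<lambda>(i, j). if i = j then es ! i else 0)"
    using Cons(1)[OF B] by blast
  let ?D' = "mat ?m ?m (\<lambda>(i, j). if i = j then es ! i else 0)"
  let ?D = "mat n n (\<lambda>(i, j). if i = j then (e # es) ! i else 0)"
  have D_block: "?D = four_block_mat E (0\<^sub>m 1 ?m) (0\<^sub>m ?m 1) ?D'"
    using n by (intro eq_matI) (auto simp: E_def nth_Cons')
  \<comment> \<open>The unitary of the smaller block, extended by 1 on the split-off
    eigenvector.\<close>
  define F where "F = four_block_mat (1\<^sub>m 1) (0\<^sub>m 1 ?m) (0\<^sub>m ?m 1) P"
  have F: "F \<in> carrier_mat n n" using P n by (auto simp: F_def)
  have FF: "mat_adjoint F * F = 1\<^sub>m n"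
  proof -
    have "mat_adjoint F * F = four_block_mat (1\<^sub>m 1) (0\<^sub>m 1 ?m) (0\<^sub>m ?m 1) (1\<^sub>m ?m)"
      unfolding F_def
      by (subst adjoint_four_block[of _ 1 1 _ ?m ?m], insert P, simp, simp,
          subst mult_four_block_mat[of _ 1 1 _ ?m _ ?m _ _ 1 _ ?m])
        (auto simp: PP)
    also have "\<dots> = 1\<^sub>m n" using n by (intro eq_matI) auto
    finally show ?thesis .
  qed
  have AF: "A' * F = F * ?D"
    unfolding A'_block F_def D_block
    by (subst (1 2) mult_four_block_mat[of _ 1 1 _ ?m _ ?m _ _ 1 _ ?m])
      (use P B E BP in auto)
  have AW: "A * W = W * A'"
  proof -
    have "W * A' = (W * ?W') * (A * W)"
      unfolding A'_def assoc_mult_mat[OF W' A W] by (rule assoc_mult_mat[OF W W' AWc, symmetric])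
    then show ?thesis using WW' A W by simp
  qed
  have D: "?D \<in> carrier_mat n n" by simp
  show ?case
  proof (intro bexI[of _ "W * F"] conjI)
    have "mat_adjoint (W * F) * (W * F) = mat_adjoint F * ((?W' * W) * F)"
      using W W' F mult_carrier_mat[OF W F]
      by (simp add: adjoint_mult[OF W F] assoc_mult_mat[of _ n n _ n _ n])
    then show "mat_adjoint (W * F) * (W * F) = 1\<^sub>m n" using WW FF F by simp
    have "A * (W * F) = (A * W) * F" by (rule assoc_mult_mat[OF A W F, symmetric])
    also have "\<dots> = W * (A' * F)" unfolding AW by (rule assoc_mult_mat[OF W A' F])
    also have "\<dots> = W * F * ?D" unfolding AF by (rule assoc_mult_mat[OF W F D, symmetric])
    finally show "A * (W * F) = W * F * ?D" .
  qed (use W F in auto)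
qed

section \<open>Comparison of eigenvalues\<close>

text \<open>The columns of \<open>U\<close> are orthonormal eigenvectors in ascending order of
  eigenvalue. Stated through coordinates \<open>c\<close>, this turns the form of \<open>A\<close>
  into a weighted sum of squares, which is how the spectral theorem enters all later
  estimates.\<close>

lemma hermitian_eigenbasis:
  assumes "A \<in> carrier_mat n n" "hermitian_mat A"
  shows "\<exists>U \<in> carrier_mat n n. mat_adjoint U * U = 1\<^sub>m n \<and>
    (\<forall>c \<in> carrier_vec n.
      rip (A *\<^sub>v (U *\<^sub>v c)) (U *\<^sub>v c) = (\<Sum>k<n. sorted_eigenvalues A ! k * (cmod (c $ k))\<^sup>2) \<and>
      rip (U *\<^sub>v c) (U *\<^sub>v c) = (\<Sum>k<n. (cmod (c $ k))\<^sup>2))"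
proof -
  note A = assms(1)
  obtain as where as: "char_poly A = (\<Prod>a\<leftarrow>as. [:- a, 1:])" "length as = n"
    using char_poly_factorized[OF A] by blast
  \<comment> \<open>The product of linear factors ignores their order, so the roots may be sorted
    before diagonalizing; the diagonal then matches \<open>sorted_eigenvalues\<close>.\<close>
  define es where "es = sort_key Re as"
  have cp: "char_poly A = (\<Prod>e\<leftarrow>es. [:- e, 1:])"
    unfolding as es_def prod_mset_prod_list[symmetric] by (simp add: mset_map)
  have len: "length es = n" using as by (simp add: es_def)
  have "proots (char_poly A) = mset es"
  proof -
    have "proots (\<Prod>e\<leftarrow>xs. [:- e, 1:]) = mset xs" for xs :: "complex list"
    proof (induct xs)
      case (Cons x xs)
      have "(\<Prod>e\<leftarrow>xs. [:- e, 1:]) \<noteq> 0" by (auto simp: prod_list_zero_iff)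
      then show ?case using Cons by (simp add: proots_mult del: mult_pCons_left)
    qed simp
    then show ?thesis unfolding cp .
  qed
  then have "sorted_eigenvalues A = sort (map Re es)"
    by (simp add: sorted_eigenvalues_def flip: mset_map)
  also have "\<dots> = map Re es" by (simp add: es_def sorted_sort_id)
  finally have ev: "sorted_eigenvalues A = map Re es" .
  let ?D = "mat n n (\<lambda>(i, j). if i = j then es ! i else 0)"
  obtain U where U: "U \<in> carrier_mat n n" and UU: "mat_adjoint U * U = 1\<^sub>m n"
    and AU: "A * U = U * ?D"
    using hermitian_diagonalization[OF assms cp] by blast
  have U': "mat_adjoint U \<in> carrier_mat n n" using U by simp
  show ?thesis
  proof (intro bexI[of _ U] conjI ballI)
    fix c :: "complex vec" assume c: "c \<in> carrier_vec n"
    have Uc: "U *\<^sub>v c \<in> carrier_vec n" using U c by simp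
    have D: "?D \<in> carrier_mat n n" by simp
    have Dc: "?D *\<^sub>v c \<in> carrier_vec n" by (rule mult_mat_vec_carrier[OF D c])
    \<comment> \<open>Unitarity of \<open>U\<close> removes it from both arguments of the inner
      product.\<close>
    have iso: "rip (U *\<^sub>v x) (U *\<^sub>v c) = rip x c" if x: "x \<in> carrier_vec n" for x
      unfolding rip_adjoint[OF U x Uc] assoc_mult_mat_vec[OF U' U c, symmetric] UU using c by simp
    show "rip (U *\<^sub>v c) (U *\<^sub>v c) = (\<Sum>k<n. (cmod (c $ k))\<^sup>2)"
      unfolding iso[OF c] by (rule rip_self_sum[OF c])
    have Dck: "(?D *\<^sub>v c) $ k = es ! k * c $ k" if "k < n" for k
      unfolding mult_mat_vec_index[OF D c that] using that
      by (subst sum.remove[of _ k]) (auto intro!: sum.neutral)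
    have "A *\<^sub>v (U *\<^sub>v c) = U *\<^sub>v (?D *\<^sub>v c)"
      unfolding assoc_mult_mat_vec[OF A U c, symmetric] AU by (rule assoc_mult_mat_vec[OF U D c])
    then have "rip (A *\<^sub>v (U *\<^sub>v c)) (U *\<^sub>v c) = rip (?D *\<^sub>v c) c" using iso[OF Dc] by simp
    also have "\<dots> = (\<Sum>k<n. Re (es ! k * c $ k * cnj (c $ k)))"
      unfolding rip_sum[OF Dc c] by (intro sum.cong refl arg_cong[of _ _ Re]) (simp only: Dck lessThan_iff)
    also have "\<dots> = (\<Sum>k<n. sorted_eigenvalues A ! k * (cmod (c $ k))\<^sup>2)"
      unfolding ev
    proof (intro sum.cong refl)
      fix k assume "k \<in> {..<n}"
      have "Re (es ! k * c $ k * cnj (c $ k)) = Re (es ! k * complex_of_real ((cmod (c $ k))\<^sup>2))"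
        by (simp only: complex_norm_square mult.assoc)
      also have "\<dots> = Re (es ! k) * (cmod (c $ k))\<^sup>2" by simp
      finally show "Re (es ! k * c $ k * cnj (c $ k)) = map Re es ! k * (cmod (c $ k))\<^sup>2"
        using \<open>k \<in> {..<n}\<close> len by simp
    qed
    finally show "rip (A *\<^sub>v (U *\<^sub>v c)) (U *\<^sub>v c) =
        (\<Sum>k<n. sorted_eigenvalues A ! k * (cmod (c $ k))\<^sup>2)" .
  qed (use U UU in auto)
qed

lemma sorted_eigenvalues_mono:
  assumes "A \<in> carrier_mat n n" "i \<le> k" "k < n"
  shows "sorted_eigenvalues A ! i \<le> sorted_eigenvalues A ! k"
  using assms length_sorted_eigenvalues[OF assms(1)]
  by (intro sorted_nth_mono) (auto simp: sorted_eigenvalues_def)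

text \<open>There are \<open>j - 1\<close> equations in \<open>j\<close> unknowns. Padding with a
  zero row gives a square matrix whose transpose kills the last unit vector, so its determinant
  vanishes and it has a nontrivial kernel.\<close>

lemma underdetermined_kernel:
  fixes N :: "nat \<Rightarrow> nat \<Rightarrow> complex"
  assumes "j \<ge> 1"
  shows "\<exists>c \<in> carrier_vec j. c \<noteq> 0\<^sub>v j \<and> (\<forall>a<j - 1. (\<Sum>b<j. N a b * c $ b) = 0)"
proof -
  define K where "K = mat j j (\<lambda>(a, b). if a < j - 1 then N a b else 0)"
  have K: "K \<in> carrier_mat j j" by (simp add: K_def)
  have K': "transpose_mat K \<in> carrier_mat j j" using K by simp
  have "det (transpose_mat K) = 0"
    unfolding det_0_iff_vec_prod_zero[OF K']
  proof (intro exI conjI)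
    show "transpose_mat K *\<^sub>v unit_vec j (j - 1) = 0\<^sub>v j"
      using K assms by (intro eq_vecI) (auto simp: K_def)
    show "unit_vec j (j - 1) \<noteq> (0\<^sub>v j :: complex vec)" using assms by simp
  qed simp
  then have "det K = 0" using det_transpose[OF K] by simp
  then obtain c where c: "c \<in> carrier_vec j" "c \<noteq> 0\<^sub>v j" "K *\<^sub>v c = 0\<^sub>v j"
    using det_0_iff_vec_prod_zero[OF K] by blast
  have "(\<Sum>b<j. N a b * c $ b) = 0" if "a < j - 1" for a
  proof -
    have "(\<Sum>b<j. N a b * c $ b) = (K *\<^sub>v c) $ a"
      using that by (subst mult_mat_vec_index[OF K c(1)]) (auto simp: K_def)
    then show ?thesis using c(3) that by simp
  qed
  then show ?thesis using c by blast
qed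

text \<open>A Courant--Fischer comparison: \<open>M\<close> maps the span of the first \<open>j\<close> eigenvectors of \<open>A\<close>
  injectively, so its image meets the span of all but the first \<open>j - 1\<close> eigenvectors of \<open>H\<close>.\<close>

lemma nth_eigenvalue_le:
  assumes A: "A \<in> carrier_mat d d" "hermitian_mat A"
    and H: "H \<in> carrier_mat e e" "hermitian_mat H"
    and M: "M \<in> carrier_mat e d"
    and j: "1 \<le> j" "j \<le> d" "j \<le> e"
    and bound: "\<And>v. \<lbrakk>v \<in> carrier_vec d; v \<noteq> 0\<^sub>v d; rip (A *\<^sub>v v) v \<le> nth_eigenvalue j A * rip v v\<rbrakk> \<Longrightarrow>
      M *\<^sub>v v \<noteq> 0\<^sub>v e \<and> rip (H *\<^sub>v (M *\<^sub>v v)) (M *\<^sub>v v) \<le> \<mu> * rip (M *\<^sub>v v) (M *\<^sub>v v)"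
  shows "nth_eigenvalue j H \<le> \<mu>"
proof -
  obtain U where U: "U \<in> carrier_mat d d" and UU: "mat_adjoint U * U = 1\<^sub>m d"
    and qA: "\<And>c. c \<in> carrier_vec d \<Longrightarrow>
        rip (A *\<^sub>v (U *\<^sub>v c)) (U *\<^sub>v c) = (\<Sum>k<d. sorted_eigenvalues A ! k * (cmod (c $ k))\<^sup>2)"
    and nU: "\<And>c. c \<in> carrier_vec d \<Longrightarrow> rip (U *\<^sub>v c) (U *\<^sub>v c) = (\<Sum>k<d. (cmod (c $ k))\<^sup>2)"
    using hermitian_eigenbasis[OF A] by blast
  obtain W where W: "W \<in> carrier_mat e e" and WW: "mat_adjoint W * W = 1\<^sub>m e"
    and qH: "\<And>c. c \<in> carrier_vec e \<Longrightarrow>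
        rip (H *\<^sub>v (W *\<^sub>v c)) (W *\<^sub>v c) = (\<Sum>k<e. sorted_eigenvalues H ! k * (cmod (c $ k))\<^sup>2)"
    and nW: "\<And>c. c \<in> carrier_vec e \<Longrightarrow> rip (W *\<^sub>v c) (W *\<^sub>v c) = (\<Sum>k<e. (cmod (c $ k))\<^sup>2)"
    using hermitian_eigenbasis[OF H] by blast
  have W': "mat_adjoint W \<in> carrier_mat e e" using W by simp
  have WW': "W * mat_adjoint W = 1\<^sub>m e" using mat_mult_left_right_inverse[OF W' W WW] .
  \<comment> \<open>The matrix of \<open>M\<close> with respect to the eigenbases of
    \<open>A\<close> and \<open>H\<close>.\<close>
  define N where "N = mat_adjoint W * (M * U)"
  have MU: "M * U \<in> carrier_mat e d" using M U by simp
  have N: "N \<in> carrier_mat e d" unfolding N_def using mult_carrier_mat[OF W' MU] .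
  obtain c where c: "c \<in> carrier_vec j" "c \<noteq> 0\<^sub>v j"
    and Nc: "\<And>a. a < j - 1 \<Longrightarrow> (\<Sum>b<j. N $$ (a, b) * c $ b) = 0"
    using underdetermined_kernel[OF j(1), of "\<lambda>a b. N $$ (a, b)"] by blast
  \<comment> \<open>Padding by zeros keeps \<open>v\<close> in the span of the first
    \<open>j\<close> eigenvectors of \<open>A\<close>.\<close>
  define c' where "c' = vec d (\<lambda>i. if i < j then c $ i else 0)"
  have c': "c' \<in> carrier_vec d" by (simp add: c'_def)
  define v where "v = U *\<^sub>v c'"
  have v: "v \<in> carrier_vec d" unfolding v_def using mult_mat_vec_carrier[OF U c'] .
  define w where "w = N *\<^sub>v c'"
  have w: "w \<in> carrier_vec e" unfolding w_def using mult_mat_vec_carrier[OF N c'] .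
  have Mv: "M *\<^sub>v v = W *\<^sub>v w"
  proof -
    have "W *\<^sub>v w = (W * N) *\<^sub>v c'" unfolding w_def using assoc_mult_mat_vec[OF W N c'] by simp
    also have "W * N = (W * mat_adjoint W) * (M * U)"
      unfolding N_def using assoc_mult_mat[OF W W' MU] by simp
    also have "\<dots> = M * U" unfolding WW' using left_mult_one_mat[OF MU] .
    finally show ?thesis unfolding v_def using assoc_mult_mat_vec[OF M U c'] by simp
  qed
  \<comment> \<open>The choice of \<open>c\<close> removes the components of
    \<open>M *\<^sub>v v\<close> along the first \<open>j - 1\<close> eigenvectors of
    \<open>H\<close>. With indices from 0, the \<open>j\<close>-th eigenvalue sits at position
    \<open>j - 1\<close>.\<close>
  have w0: "w $ a = 0" if "a < j - 1" for a
  proof -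
    have "w $ a = (\<Sum>b<d. N $$ (a, b) * c' $ b)"
      unfolding w_def using that j by (intro mult_mat_vec_index[OF N c']) auto
    also have "\<dots> = (\<Sum>b<j. N $$ (a, b) * c' $ b)"
      using j by (intro sum.mono_neutral_right) (auto simp: c'_def)
    also have "\<dots> = (\<Sum>b<j. N $$ (a, b) * c $ b)"
      using j by (intro sum.cong) (auto simp: c'_def)
    finally show ?thesis using Nc[OF that] by simp
  qed
  have "\<exists>i<j. c $ i \<noteq> 0" using c by (metis carrier_vecD eq_vecI index_zero_vec)
  then obtain i where i: "i < j" "c $ i \<noteq> 0" by blast
  have "0 < (cmod (c' $ i))\<^sup>2" using i j by (simp add: c'_def)
  also have "\<dots> \<le> (\<Sum>k<d. (cmod (c' $ k))\<^sup>2)" using i j by (intro member_le_sum) auto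
  finally have "rip v v > 0" using nU[OF c'] by (simp add: v_def)
  then have v0: "v \<noteq> 0\<^sub>v d" using rip_self_eq_0[OF v] by auto
  have "rip (A *\<^sub>v v) v \<le> (\<Sum>k<d. nth_eigenvalue j A * (cmod (c' $ k))\<^sup>2)"
    unfolding v_def qA[OF c'] nth_eigenvalue_def
  proof (intro sum_mono)
    \<comment> \<open>Either the eigenvalue is at most the \<open>j\<close>-th one, or the
      coordinate is zero.\<close>
    fix k assume "k \<in> {..<d}"
    then show "sorted_eigenvalues A ! k * (cmod (c' $ k))\<^sup>2 \<le> sorted_eigenvalues A ! (j - 1) * (cmod (c' $ k))\<^sup>2"
      using sorted_eigenvalues_mono[OF A(1), of k "j - 1"] j
      by (cases "k < j") (auto intro!: mult_right_mono simp: c'_def)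
  qed
  also have "\<dots> = nth_eigenvalue j A * rip v v"
    unfolding v_def nU[OF c'] by (simp add: sum_distrib_left)
  finally have *: "M *\<^sub>v v \<noteq> 0\<^sub>v e" "rip (H *\<^sub>v (M *\<^sub>v v)) (M *\<^sub>v v) \<le> \<mu> * rip (M *\<^sub>v v) (M *\<^sub>v v)"
    using bound[OF v v0] by auto
  have "nth_eigenvalue j H * rip (M *\<^sub>v v) (M *\<^sub>v v) = (\<Sum>k<e. nth_eigenvalue j H * (cmod (w $ k))\<^sup>2)"
    unfolding Mv nW[OF w] by (simp add: sum_distrib_left)
  also have "\<dots> \<le> rip (H *\<^sub>v (M *\<^sub>v v)) (M *\<^sub>v v)"
    unfolding Mv qH[OF w] nth_eigenvalue_def
  proof (intro sum_mono)
    \<comment> \<open>The reverse situation: coordinates before position \<open>j - 1\<close>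
      vanish, and the later eigenvalues are at least the \<open>j\<close>-th one.\<close>
    fix k assume "k \<in> {..<e}"
    then show "sorted_eigenvalues H ! (j - 1) * (cmod (w $ k))\<^sup>2 \<le> sorted_eigenvalues H ! k * (cmod (w $ k))\<^sup>2"
      using sorted_eigenvalues_mono[OF H(1), of "j - 1" k] j w0[of k]
      by (cases "k < j - 1") (auto intro!: mult_right_mono)
  qed
  also note *(2)
  finally have "nth_eigenvalue j H * rip (M *\<^sub>v v) (M *\<^sub>v v) \<le> \<mu> * rip (M *\<^sub>v v) (M *\<^sub>v v)" .
  moreover have "rip (M *\<^sub>v v) (M *\<^sub>v v) > 0"
    using *(1) rip_self_eq_0[OF mult_mat_vec_carrier[OF M v]] rip_nonneg[of "M *\<^sub>v v"] by linarith
  ultimately show ?thesis by simp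
qed

section \<open>Crude bounds on quadratic forms and eigenvalues\<close>

lemma hermitian_form_bounded:
  assumes "A \<in> carrier_mat n n" "hermitian_mat A"
  shows "\<exists>a\<ge>0. \<forall>v\<in>carrier_vec n. \<bar>rip (A *\<^sub>v v) v\<bar> \<le> a * rip v v"
proof -
  obtain U where U: "U \<in> carrier_mat n n" and UU: "mat_adjoint U * U = 1\<^sub>m n"
    and qA: "\<And>c. c \<in> carrier_vec n \<Longrightarrow>
        rip (A *\<^sub>v (U *\<^sub>v c)) (U *\<^sub>v c) = (\<Sum>k<n. sorted_eigenvalues A ! k * (cmod (c $ k))\<^sup>2)"
    and nU: "\<And>c. c \<in> carrier_vec n \<Longrightarrow> rip (U *\<^sub>v c) (U *\<^sub>v c) = (\<Sum>k<n. (cmod (c $ k))\<^sup>2)"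
    using hermitian_eigenbasis[OF assms] by blast
  have U': "mat_adjoint U \<in> carrier_mat n n" using U by simp
  have UU': "U * mat_adjoint U = 1\<^sub>m n" using mat_mult_left_right_inverse[OF U' U UU] .
  \<comment> \<open>The sum of the absolute values dominates every single eigenvalue, hence the form
    in eigenbasis coordinates.\<close>
  let ?a = "\<Sum>k<n. \<bar>sorted_eigenvalues A ! k\<bar>"
  show ?thesis
  proof (intro exI[of _ ?a] conjI ballI)
    fix v :: "complex vec" assume v: "v \<in> carrier_vec n"
    define c where "c = mat_adjoint U *\<^sub>v v"
    have c: "c \<in> carrier_vec n" unfolding c_def using mult_mat_vec_carrier[OF U' v] .
    have vc: "v = U *\<^sub>v c"
      unfolding c_def assoc_mult_mat_vec[OF U U' v, symmetric] UU' using v by simp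
    have "\<bar>rip (A *\<^sub>v v) v\<bar> \<le> (\<Sum>k<n. \<bar>sorted_eigenvalues A ! k * (cmod (c $ k))\<^sup>2\<bar>)"
      unfolding vc qA[OF c] by (rule sum_abs)
    also have "\<dots> \<le> (\<Sum>k<n. ?a * (cmod (c $ k))\<^sup>2)"
      by (intro sum_mono) (auto simp: abs_mult intro!: mult_right_mono member_le_sum)
    finally show "\<bar>rip (A *\<^sub>v v) v\<bar> \<le> ?a * rip v v"
      unfolding vc nU[OF c] by (simp add: sum_distrib_left)
  qed (simp add: sum_nonneg)
qed

lemma nth_eigenvalue_bounded:
  assumes A: "A \<in> carrier_mat n n"
  shows "\<exists>b\<ge>0. \<forall>j\<in>{1..n}. \<bar>nth_eigenvalue j A\<bar> \<le> b"
proof (intro exI[of _ "\<Sum>k<n. \<bar>sorted_eigenvalues A ! k\<bar>"] conjI ballI)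
  fix j assume "j \<in> {1..n}"
  then have "j - 1 \<in> {..<n}" by auto
  then show "\<bar>nth_eigenvalue j A\<bar> \<le> (\<Sum>k<n. \<bar>sorted_eigenvalues A ! k\<bar>)"
    unfolding nth_eigenvalue_def by (intro member_le_sum[of _ _ "\<lambda>k. \<bar>sorted_eigenvalues A ! k\<bar>"]) auto
qed (simp add: sum_nonneg)

section \<open>Block gadgets\<close>

text \<open>The slack qubit is the last one, hence the least significant bit of an index.\<close>

definition interleave :: "complex vec \<Rightarrow> complex vec \<Rightarrow> complex vec" where
  "interleave x y = vec (2 * dim_vec x) (\<lambda>i. if even i then x $ (i div 2) else y $ (i div 2))"

lemma interleave_carrier [simp]: "x \<in> carrier_vec d \<Longrightarrow> interleave x y \<in> carrier_vec (2 * d)"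
  by (simp add: interleave_def)

lemma interleave_index:
  assumes "x \<in> carrier_vec d" "i < d"
  shows "interleave x y $ (2 * i) = x $ i" "interleave x y $ Suc (2 * i) = y $ i"
  using assms by (auto simp: interleave_def)

lemma interleave_cases:
  assumes "u \<in> carrier_vec (2 * d)"
  obtains x y where "x \<in> carrier_vec d" "y \<in> carrier_vec d" "u = interleave x y"
proof
  show "u = interleave (vec d (\<lambda>i. u $ (2 * i))) (vec d (\<lambda>i. u $ Suc (2 * i)))"
    using assms by (intro eq_vecI) (auto simp: interleave_def)
qed auto

lemma sum_even_odd: "(\<Sum>i<2 * d. f i) = (\<Sum>i<d. f (2 * i) + f (Suc (2 * i)))"
  for f :: "nat \<Rightarrow> 'a::comm_monoid_add"
  by (induct d) (simp_all add: add.assoc)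

lemma rip_interleave:
  assumes "x \<in> carrier_vec d" "y \<in> carrier_vec d" "x' \<in> carrier_vec d" "y' \<in> carrier_vec d"
  shows "rip (interleave x y) (interleave x' y') = rip x x' + rip y y'"
  unfolding rip_sum[OF interleave_carrier[OF assms(1)] interleave_carrier[OF assms(3)]]
    rip_sum[OF assms(1,3)] rip_sum[OF assms(2,4)] sum_even_odd sum.distrib[symmetric]
  using assms by (intro sum.cong refl) (simp add: interleave_index)

lemma interleave_add:
  assumes "x \<in> carrier_vec d" "y \<in> carrier_vec d" "x' \<in> carrier_vec d" "y' \<in> carrier_vec d"
  shows "interleave x y + interleave x' y' = interleave (x + x') (y + y')"
  using assms by (intro eq_vecI) (auto simp: interleave_def less_mult_imp_div_less mult.commute)

lemma interleave_smult:
  assumes "x \<in> carrier_vec d" "y \<in> carrier_vec d"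
  shows "c \<cdot>\<^sub>v interleave x y = interleave (c \<cdot>\<^sub>v x) (c \<cdot>\<^sub>v y)"
  using assms by (intro eq_vecI) (auto simp: interleave_def less_mult_imp_div_less mult.commute)

section \<open>Kronecker products acting on interleaved vectors\<close>

lemma kron_carrier [simp]:
  "A \<in> carrier_mat r c \<Longrightarrow> B \<in> carrier_mat r' c' \<Longrightarrow> kron A B \<in> carrier_mat (r * r') (c * c')"
  by (simp add: kron_def)

text \<open>The slack bit of an index is its remainder modulo 2, so \<open>kron A P\<close> acts on
  the pair \<open>(x, y)\<close> as the two by two block matrix with blocks
  \<open>P $$ (a, b)\<close> times \<open>A\<close>.\<close>

lemma kron_mult_interleave:
  assumes A: "A \<in> carrier_mat d d" and P: "P \<in> carrier_mat 2 2"
    and x: "x \<in> carrier_vec d" and y: "y \<in> carrier_vec d"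
  shows "kron A P *\<^sub>v interleave x y =
    interleave (P $$ (0, 0) \<cdot>\<^sub>v (A *\<^sub>v x) + P $$ (0, 1) \<cdot>\<^sub>v (A *\<^sub>v y))
      (P $$ (1, 0) \<cdot>\<^sub>v (A *\<^sub>v x) + P $$ (1, 1) \<cdot>\<^sub>v (A *\<^sub>v y))"
    (is "_ = ?R")
proof (rule eq_vecI)
  have K: "kron A P \<in> carrier_mat (2 * d) (2 * d)" using kron_carrier[OF A P] by (simp add: mult.commute)
  show "dim_vec (kron A P *\<^sub>v interleave x y) = dim_vec ?R"
    using K A x by (simp add: interleave_def)
  fix i assume "i < dim_vec ?R"
  then have i: "i < 2 * d" using A by (simp add: interleave_def)
  then have i2: "i div 2 < d" by auto
  have "(kron A P *\<^sub>v interleave x y) $ i =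
      (\<Sum>k<d. A $$ (i div 2, k) * P $$ (i mod 2, 0) * x $ k + A $$ (i div 2, k) * P $$ (i mod 2, 1) * y $ k)"
    unfolding mult_mat_vec_index[OF K interleave_carrier[OF x] i] sum_even_odd
    using A P i by (intro sum.cong refl) (auto simp: interleave_index[OF x] kron_def mult.commute[of d])
  also have "\<dots> = P $$ (i mod 2, 0) * (A *\<^sub>v x) $ (i div 2) + P $$ (i mod 2, 1) * (A *\<^sub>v y) $ (i div 2)"
    unfolding mult_mat_vec_index[OF A x i2] mult_mat_vec_index[OF A y i2]
    by (simp add: sum.distrib sum_distrib_left mult_ac)
  also have "\<dots> = ?R $ i"
    using i i2 A by (auto simp: interleave_def mod2_eq_if)
  finally show "(kron A P *\<^sub>v interleave x y) $ i = ?R $ i" .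
qed

text \<open>Here \<open>l\<close> is the square root of the penalty scale. With slack energy of
  order \<open>l\<^sup>2\<close> and coupling of order \<open>l\<close>, the second-order term of
  the Schur complement does not depend on \<open>l\<close>. \<open>A\<close> acts on both slack
  states alike, since restricting it to one of them would multiply its pair terms by a slack
  \<open>Z\<close>.\<close>

definition gadget :: "real \<Rightarrow> complex mat \<Rightarrow> complex mat \<Rightarrow> complex mat \<Rightarrow> complex mat" where
  "gadget l A D R = complex_of_real (l\<^sup>2) \<cdot>\<^sub>m kron D ketbra1 + kron A (1\<^sub>m 2) + complex_of_real l \<cdot>\<^sub>m kron R pauliX"

lemma pauli_carrier [simp]:
  "pauliX \<in> carrier_mat 2 2" "pauliY \<in> carrier_mat 2 2" "pauliZ \<in> carrier_mat 2 2" "ketbra1 \<in> carrier_mat 2 2"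
  by (auto simp: pauliX_def pauliY_def pauliZ_def ketbra1_def mat_of_rows_list_def)

lemma pauli_index [simp]:
  "pauliX $$ (0, 0) = 0" "pauliX $$ (0, Suc 0) = 1" "pauliX $$ (Suc 0, 0) = 1" "pauliX $$ (Suc 0, Suc 0) = 0"
  "pauliY $$ (0, 0) = 0" "pauliY $$ (0, Suc 0) = - \<i>" "pauliY $$ (Suc 0, 0) = \<i>" "pauliY $$ (Suc 0, Suc 0) = 0"
  "pauliZ $$ (0, 0) = 1" "pauliZ $$ (0, Suc 0) = 0" "pauliZ $$ (Suc 0, 0) = 0" "pauliZ $$ (Suc 0, Suc 0) = -1"
  "ketbra1 $$ (0, 0) = 0" "ketbra1 $$ (0, Suc 0) = 0" "ketbra1 $$ (Suc 0, 0) = 0" "ketbra1 $$ (Suc 0, Suc 0) = 1"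
  by (auto simp: pauliX_def pauliY_def pauliZ_def ketbra1_def mat_of_rows_list_def)

lemma gadget_carrier:
  assumes "A \<in> carrier_mat d d" "D \<in> carrier_mat d d" "R \<in> carrier_mat d d"
  shows "gadget l A D R \<in> carrier_mat (2 * d) (2 * d)"
  using kron_carrier[OF assms(1) one_carrier_mat[of 2]] kron_carrier[OF assms(2) pauli_carrier(4)]
    kron_carrier[OF assms(3) pauli_carrier(1)]
  by (simp add: gadget_def mult.commute)

lemma zero_smult_vec: "v \<in> carrier_vec d \<Longrightarrow> (0 :: complex) \<cdot>\<^sub>v v = 0\<^sub>v d"
  by (intro eq_vecI) auto

lemma smult_mat_mult_vec:
  assumes "A \<in> carrier_mat r c" "v \<in> carrier_vec c"
  shows "(k \<cdot>\<^sub>m A) *\<^sub>v v = k \<cdot>\<^sub>v (A *\<^sub>v (v :: complex vec))"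
  using assms by (intro eq_vecI) auto

lemma gadget_mult_interleave:
  assumes A: "A \<in> carrier_mat d d" and D: "D \<in> carrier_mat d d" and R: "R \<in> carrier_mat d d"
    and x: "x \<in> carrier_vec d" and y: "y \<in> carrier_vec d"
  shows "gadget l A D R *\<^sub>v interleave x y =
    interleave (A *\<^sub>v x + complex_of_real l \<cdot>\<^sub>v (R *\<^sub>v y))
      (complex_of_real (l\<^sup>2) \<cdot>\<^sub>v (D *\<^sub>v y) + A *\<^sub>v y + complex_of_real l \<cdot>\<^sub>v (R *\<^sub>v x))"
proof -
  have K: "kron D ketbra1 \<in> carrier_mat (2 * d) (2 * d)" "kron A (1\<^sub>m 2) \<in> carrier_mat (2 * d) (2 * d)"
      "kron R pauliX \<in> carrier_mat (2 * d) (2 * d)"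
    using kron_carrier[OF A one_carrier_mat[of 2]] kron_carrier[OF D pauli_carrier(4)]
      kron_carrier[OF R pauli_carrier(1)] by (simp_all add: mult.commute)
  note v = interleave_carrier[OF x, of y]
  have c: "A *\<^sub>v x \<in> carrier_vec d" "A *\<^sub>v y \<in> carrier_vec d" "D *\<^sub>v x \<in> carrier_vec d"
    "D *\<^sub>v y \<in> carrier_vec d" "R *\<^sub>v x \<in> carrier_vec d" "R *\<^sub>v y \<in> carrier_vec d"
    using A D R x y by auto
  have z: "complex_of_real (l\<^sup>2) \<cdot>\<^sub>v 0\<^sub>v d = 0\<^sub>v d" by (intro eq_vecI) auto
  have "kron D ketbra1 *\<^sub>v interleave x y = interleave (0\<^sub>v d) (D *\<^sub>v y)"
    unfolding kron_mult_interleave[OF D pauli_carrier(4) x y] using c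
    by (simp add: zero_smult_vec[of _ d])
  moreover have "kron A (1\<^sub>m 2) *\<^sub>v interleave x y = interleave (A *\<^sub>v x) (A *\<^sub>v y)"
    unfolding kron_mult_interleave[OF A one_carrier_mat x y] using c
    by (simp add: zero_smult_vec[of _ d])
  moreover have "kron R pauliX *\<^sub>v interleave x y = interleave (R *\<^sub>v y) (R *\<^sub>v x)"
    unfolding kron_mult_interleave[OF R pauli_carrier(1) x y] using c
    by (simp add: zero_smult_vec[of _ d])
  ultimately have "gadget l A D R *\<^sub>v interleave x y =
      complex_of_real (l\<^sup>2) \<cdot>\<^sub>v interleave (0\<^sub>v d) (D *\<^sub>v y) + interleave (A *\<^sub>v x) (A *\<^sub>v y) +
      complex_of_real l \<cdot>\<^sub>v interleave (R *\<^sub>v y) (R *\<^sub>v x)"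
    using K v
    by (simp add: gadget_def add_mult_distrib_mat_vec[of _ "2 * d" "2 * d"] smult_mat_mult_vec[of _ "2 * d" "2 * d"])
  also have "\<dots> = interleave (A *\<^sub>v x + complex_of_real l \<cdot>\<^sub>v (R *\<^sub>v y))
      (complex_of_real (l\<^sup>2) \<cdot>\<^sub>v (D *\<^sub>v y) + A *\<^sub>v y + complex_of_real l \<cdot>\<^sub>v (R *\<^sub>v x))"
    using c by (simp add: interleave_smult[of _ d] interleave_add[of _ d] z del: of_real_power)
  finally show ?thesis .
qed

text \<open>Completing the square in the slack block; \<open>T\<close> is the Schur complement of \<open>l\<^sup>2 D\<close>.\<close>

lemma gadget_form:
  assumes T: "T \<in> carrier_mat d d" and D: "D \<in> carrier_mat d d" "hermitian_mat D"
    and R: "R \<in> carrier_mat d d" "hermitian_mat R" and G: "G \<in> carrier_mat d d"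
    and DG: "D * G = R" and A: "A = T + R * G"
    and x: "x \<in> carrier_vec d" and y: "y \<in> carrier_vec d" and l: "l > 0"
    and z: "z = y + complex_of_real (1 / l) \<cdot>\<^sub>v (G *\<^sub>v x)"
  shows "rip (gadget l A D R *\<^sub>v interleave x y) (interleave x y) =
    rip (T *\<^sub>v x) x + rip (A *\<^sub>v y) y + l\<^sup>2 * rip (D *\<^sub>v z) z"
proof -
  have RG: "R * G \<in> carrier_mat d d" using mult_carrier_mat[OF R(1) G] .
  have Ac: "A \<in> carrier_mat d d" using T RG A by simp
  note c = mult_mat_vec_carrier[OF Ac x] mult_mat_vec_carrier[OF Ac y] mult_mat_vec_carrier[OF R(1) x]
    mult_mat_vec_carrier[OF R(1) y] mult_mat_vec_carrier[OF D(1) y] mult_mat_vec_carrier[OF G x]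
    mult_mat_vec_carrier[OF T x] mult_mat_vec_carrier[OF RG x]
  have DGx: "D *\<^sub>v (G *\<^sub>v x) = R *\<^sub>v x" using assoc_mult_mat_vec[OF D(1) G x] DG by simp
  have Dz: "D *\<^sub>v z = D *\<^sub>v y + complex_of_real (1 / l) \<cdot>\<^sub>v (R *\<^sub>v x)"
    unfolding z using c y mult_add_distrib_mat_vec[OF D(1) y, of "complex_of_real (1 / l) \<cdot>\<^sub>v (G *\<^sub>v x)"]
    by (simp add: mult_mat_vec[OF D(1) c(6)] DGx)
  \<comment> \<open>Moving \<open>D\<close> to the other side and using \<open>D * G = R\<close>
    brings back the coupling.\<close>
  have 1: "rip (D *\<^sub>v y) (G *\<^sub>v x) = rip (R *\<^sub>v y) x"
    unfolding rip_hermitian[OF D y c(6)] rip_hermitian[OF R y x] DGx ..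
  have 2: "rip (R *\<^sub>v x) (G *\<^sub>v x) = rip ((R * G) *\<^sub>v x) x"
    unfolding assoc_mult_mat_vec[OF R(1) G x] rip_hermitian[OF R c(6) x] by (rule rip_commute[OF c(3,6)])
  have Ax: "rip (A *\<^sub>v x) x = rip (T *\<^sub>v x) x + rip ((R * G) *\<^sub>v x) x"
    unfolding A add_mult_distrib_mat_vec[OF T RG x] by (rule rip_add_left[OF c(7,8) x])
  \<comment> \<open>The cross terms of the square are the coupling. Its term in \<open>x\<close>
    alone is the form of \<open>R * G\<close>, which is the excess of \<open>A\<close> over
    \<open>T\<close>.\<close>
  have "rip (D *\<^sub>v z) z = rip (D *\<^sub>v y) y + 1 / l * rip (R *\<^sub>v x) y + 1 / l * rip (R *\<^sub>v y) x +
      1 / l * (1 / l * rip ((R * G) *\<^sub>v x) x)"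
    unfolding Dz unfolding z using c y
    by (simp add: rip_add_left[of _ d] rip_add_right[of _ d] rip_smult_left[of _ d] rip_smult_right[of _ d] 1 2
        del: of_real_divide of_real_1) (simp add: add_divide_distrib algebra_simps)
  then have "l\<^sup>2 * rip (D *\<^sub>v z) z = l\<^sup>2 * rip (D *\<^sub>v y) y + l * rip (R *\<^sub>v x) y + l * rip (R *\<^sub>v y) x +
      rip ((R * G) *\<^sub>v x) x"
    using l by (simp add: power2_eq_square field_simps)
  moreover have "rip (gadget l A D R *\<^sub>v interleave x y) (interleave x y) =
      rip (A *\<^sub>v x) x + l * rip (R *\<^sub>v y) x + (l\<^sup>2 * rip (D *\<^sub>v y) y + rip (A *\<^sub>v y) y + l * rip (R *\<^sub>v x) y)"
    unfolding gadget_mult_interleave[OF Ac D(1) R(1) x y] using c x y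
    by (simp add: rip_interleave[of _ d] rip_add_left[of _ d] rip_smult_left[of _ d] del: of_real_power)
  ultimately show ?thesis using Ax by simp
qed

text \<open>The parallelogram law with the square of the difference dropped.\<close>

lemma rip_add_le:
  assumes "x \<in> carrier_vec d" "y \<in> carrier_vec d"
  shows "rip (x + y) (x + y) \<le> 2 * rip x x + 2 * rip y y"
proof -
  let ?n = "x + complex_of_real (-1) \<cdot>\<^sub>v y"
  have "rip (x + y) (x + y) + rip ?n ?n = 2 * rip x x + 2 * rip y y"
    using assms
    by (simp add: rip_add_left[of _ d] rip_add_right[of _ d] rip_smult_left[of _ d] rip_smult_right[of _ d]
        del: of_real_minus of_real_1)
  then show ?thesis using rip_nonneg[of ?n] by linarith
qed

text \<open>Two eigenvalue comparisons based on \<open>gadget_form\<close>. Upward, a vector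
  \<open>x\<close> is lifted to \<open>(x, - G x / l)\<close>, for which the completed square
  vanishes. Downward, a low-energy vector \<open>(x, y)\<close> is projected to \<open>x\<close>;
  the penalty \<open>l\<^sup>2 D\<close> controls the completed square. In both cases the error
  comes from the form of \<open>A\<close> on the slack component, whose squared norm is of order
  \<open>l\<^sup>-\<^sup>2\<close> relative to \<open>x\<close>, up to the penalized part.\<close>

lemma gadget_eigenvalues:
  assumes T: "T \<in> carrier_mat d d" "hermitian_mat T" and D: "D \<in> carrier_mat d d" "hermitian_mat D"
    and R: "R \<in> carrier_mat d d" "hermitian_mat R" and G: "G \<in> carrier_mat d d"
    and DG: "D * G = R" and A: "A = T + R * G" "hermitian_mat A"
    and gad: "\<And>l. hermitian_mat (gadget l A D R)"
    and \<delta>: "\<delta> > 0" "\<And>v. v \<in> carrier_vec d \<Longrightarrow> \<delta> * rip v v \<le> rip (D *\<^sub>v v) v"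
  shows "\<exists>C>0. \<forall>\<epsilon> l. 0 < \<epsilon> \<longrightarrow> \<epsilon> \<le> 1 \<longrightarrow> 0 < l \<longrightarrow> C / \<epsilon> \<le> l\<^sup>2 \<longrightarrow>
    (\<forall>j\<in>{1..d}. \<bar>nth_eigenvalue j (gadget l A D R) - nth_eigenvalue j T\<bar> \<le> \<epsilon>)"
proof -
  have RG: "R * G \<in> carrier_mat d d" using mult_carrier_mat[OF R(1) G] .
  have Ac: "A \<in> carrier_mat d d" using T RG A by simp
  obtain a where a: "a \<ge> 0" "\<And>v. v \<in> carrier_vec d \<Longrightarrow> \<bar>rip (A *\<^sub>v v) v\<bar> \<le> a * rip v v"
    using hermitian_form_bounded[OF Ac A(2)] by blast
  have G': "mat_adjoint G \<in> carrier_mat d d" using G by simp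
  have GG: "mat_adjoint G * G \<in> carrier_mat d d" using mult_carrier_mat[OF G' G] .
  have "hermitian_mat (mat_adjoint G * G)"
    using adjoint_mult[OF G' G] by (simp add: hermitian_mat_def)
  \<comment> \<open>\<open>k\<close> bounds the squared operator norm of \<open>G\<close> through
    the form of its Gram matrix.\<close>
  then obtain k where k: "k \<ge> 0" "\<And>v. v \<in> carrier_vec d \<Longrightarrow> \<bar>rip ((mat_adjoint G * G) *\<^sub>v v) v\<bar> \<le> k * rip v v"
    using hermitian_form_bounded[OF GG] by blast
  have Gk: "rip (G *\<^sub>v v) (G *\<^sub>v v) \<le> k * rip v v" if v: "v \<in> carrier_vec d" for v
  proof -
    have Gv: "G *\<^sub>v v \<in> carrier_vec d" using mult_mat_vec_carrier[OF G v] .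
    have "rip (G *\<^sub>v v) (G *\<^sub>v v) = rip ((mat_adjoint G * G) *\<^sub>v v) v"
      unfolding rip_adjoint[OF G v Gv] assoc_mult_mat_vec[OF G' G v]
      using rip_commute[OF v mult_mat_vec_carrier[OF G' Gv]] .
    then show ?thesis using k(2)[OF v] by linarith
  qed
  obtain b where b: "b \<ge> 0" "\<And>j. j \<in> {1..d} \<Longrightarrow> \<bar>nth_eigenvalue j T\<bar> \<le> b"
    using nth_eigenvalue_bounded[OF T(1)] by blast
  \<comment> \<open>\<open>a\<close> controls the form of \<open>A\<close> on the slack component,
    and \<open>b + 1\<close> will bound the gadget eigenvalue from above; the factor 2 comes from
    \<open>rip_add_le\<close>.\<close>
  define s where "s = 2 * (a + b + 1)"
  have s2: "s / 2 = a + b + 1" by (simp add: s_def)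
  have s: "s > 0" using a b by (simp add: s_def)
  \<comment> \<open>The first summand makes the error \<open>s * k / l\<^sup>2\<close> at most
    \<epsilon>. The other two make the penalty strictly exceed \<open>s\<close>, using \<epsilon> at
    most 1.\<close>
  define C where "C = s * k + s / \<delta> + 1"
  have C: "C > 0" unfolding C_def using s k \<delta> by (smt (verit) divide_pos_pos mult_nonneg_nonneg)
  show ?thesis
  proof (intro exI[of _ C] conjI allI impI ballI)
    fix \<epsilon> l :: real and j assume \<epsilon>: "0 < \<epsilon>" "\<epsilon> \<le> 1" and l: "0 < l" "C / \<epsilon> \<le> l\<^sup>2" and j: "j \<in> {1..d}"
    have L: "C \<le> \<epsilon> * l\<^sup>2" using l(2) \<epsilon> by (simp add: field_simps)
    have l2: "l\<^sup>2 > 0" using l by simp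
    have "s * k \<le> C" unfolding C_def using s \<delta> by simp
    then have sk: "s * (k / l\<^sup>2) \<le> \<epsilon>" using L l2 by (simp add: field_simps)
    have "s / \<delta> < C" unfolding C_def using s k by (smt (verit) mult_nonneg_nonneg)
    also have "\<dots> \<le> l\<^sup>2" using L \<epsilon> l2 by (smt (verit) mult_left_le_one_le)
    finally have s\<delta>: "s < l\<^sup>2 * \<delta>" using \<delta> by (simp add: field_simps)
    let ?H = "gadget l A D R"
    have H: "?H \<in> carrier_mat (2 * d) (2 * d)" using gadget_carrier[OF Ac D(1) R(1)] .
    note form = gadget_form[OF T(1) D R G DG A(1) _ _ l(1)]
    define g where "g x = complex_of_real (1 / l) \<cdot>\<^sub>v (G *\<^sub>v x)" for x
    have gc: "g x \<in> carrier_vec d" if "x \<in> carrier_vec d" for x using that G by (simp add: g_def)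
    have gg: "rip (g x) (g x) \<le> k / l\<^sup>2 * rip x x" if x: "x \<in> carrier_vec d" for x
    proof -
      have Gx: "G *\<^sub>v x \<in> carrier_vec d" using mult_mat_vec_carrier[OF G x] .
      then have cc: "complex_of_real (1 / l) \<cdot>\<^sub>v (G *\<^sub>v x) \<in> carrier_vec d" by simp
      have "rip (g x) (g x) = rip (G *\<^sub>v x) (G *\<^sub>v x) / l\<^sup>2"
        unfolding g_def rip_smult_left[OF Gx cc] rip_smult_right[OF Gx Gx] by (simp add: power2_eq_square)
      then show ?thesis using Gk[OF x] l2 by (simp add: divide_right_mono)
    qed
    let ?t = "nth_eigenvalue j T" and ?h = "nth_eigenvalue j ?H"
    have t: "\<bar>?t\<bar> \<le> b" using b(2)[OF j] .
    \<comment> \<open>The lift of \<open>x\<close> to \<open>(x, - g x)\<close> as a matrix on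
      interleaved indices.\<close>
    define M where "M = mat (2 * d) d (\<lambda>(i, k). if even i then if i div 2 = k then 1 else 0
      else - (complex_of_real (1 / l) * G $$ (i div 2, k)))"
    have M: "M \<in> carrier_mat (2 * d) d" by (simp add: M_def)
    have Mx: "M *\<^sub>v x = interleave x (- g x)" if x: "x \<in> carrier_vec d" for x
    proof (rule eq_vecI)
      fix i assume "i < dim_vec (interleave x (- g x))"
      then have i: "i < 2 * d" using x by (simp add: interleave_def)
      then have i2: "i div 2 < d" by auto
      show "(M *\<^sub>v x) $ i = interleave x (- g x) $ i"
      proof (cases "even i")
        case True
        have "(\<Sum>k<d. M $$ (i, k) * x $ k) = (\<Sum>k<d. if i div 2 = k then x $ k else 0)"
          using i True by (intro sum.cong) (auto simp: M_def)
        then show ?thesis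
          unfolding mult_mat_vec_index[OF M x i] using i i2 x True by (simp add: interleave_def)
      next
        case False
        have "(\<Sum>k<d. M $$ (i, k) * x $ k) = - (complex_of_real (1 / l) * (G *\<^sub>v x) $ (i div 2))"
          unfolding mult_mat_vec_index[OF G x i2] sum_distrib_left sum_negf[symmetric]
          using i False by (intro sum.cong) (auto simp: M_def)
        then show ?thesis
          unfolding mult_mat_vec_index[OF M x i] using i i2 x False gc[OF x] G
          by (simp add: interleave_def g_def)
      qed
    qed (use M x in \<open>simp add: interleave_def\<close>)
    have upper: "?h \<le> ?t + \<epsilon>"
    proof (rule nth_eigenvalue_le[OF T H gad M])
      fix x assume x: "x \<in> carrier_vec d" "x \<noteq> 0\<^sub>v d" and q: "rip (T *\<^sub>v x) x \<le> ?t * rip x x"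
      let ?y = "- g x"
      have y: "?y \<in> carrier_vec d" using gc[OF x(1)] by simp
      \<comment> \<open>On lifted vectors the completed square is zero, so no term of order
        \<open>l\<^sup>2\<close> remains.\<close>
      have z: "0\<^sub>v d = ?y + complex_of_real (1 / l) \<cdot>\<^sub>v (G *\<^sub>v x)"
        unfolding g_def[symmetric] using gc[OF x(1)] by simp
      have yy: "rip ?y ?y \<le> k / l\<^sup>2 * rip x x"
      proof -
        have "rip ?y ?y = rip (g x) (g x)"
          using gc[OF x(1)] y by (simp add: rip_sum[of _ d])
        then show ?thesis using gg[OF x(1)] by simp
      qed
      have xx: "rip x x > 0" using x rip_self_eq_0[OF x(1)] rip_nonneg[of x] by linarith
      have u: "rip (interleave x ?y) (interleave x ?y) = rip x x + rip ?y ?y"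
        by (rule rip_interleave[OF x(1) y x(1) y])
      have "interleave x ?y \<noteq> 0\<^sub>v (2 * d)"
        using u xx rip_nonneg[of ?y] rip_self_eq_0[OF interleave_carrier[OF x(1)], of ?y] by auto
      moreover have "rip (?H *\<^sub>v interleave x ?y) (interleave x ?y) \<le>
          (?t + \<epsilon>) * rip (interleave x ?y) (interleave x ?y)"
      proof -
        have "rip (?H *\<^sub>v interleave x ?y) (interleave x ?y) = rip (T *\<^sub>v x) x + rip (A *\<^sub>v ?y) ?y"
          using form[OF x(1) y z] D by (simp add: rip_sum[of _ d])
        also have "\<dots> \<le> ?t * rip x x + a * rip ?y ?y" using q a(2)[OF y] by linarith
        \<comment> \<open>Since \<open>?t\<close> is at least \<open>- b\<close>, the bound
          \<open>a\<close> is at most \<open>?t + s\<close>. This provides the share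
          \<open>?t * rip ?y ?y\<close> needed to compare with the norm of the whole lifted
          vector.\<close>
        also have "a * rip ?y ?y \<le> ?t * rip ?y ?y + s * rip ?y ?y"
          using t a(1) b(1) rip_nonneg[of ?y]
          by (simp add: s_def flip: distrib_right) (intro mult_right_mono, auto)
        also have "s * rip ?y ?y \<le> \<epsilon> * rip x x"
        proof -
          have "s * rip ?y ?y \<le> s * (k / l\<^sup>2 * rip x x)" using s yy by (intro mult_left_mono) auto
          also have "\<dots> \<le> \<epsilon> * rip x x" using mult_right_mono[OF sk, of "rip x x"] xx by (simp add: mult.assoc)
          finally show ?thesis .
        qed
        finally show ?thesis
          using mult_nonneg_nonneg[OF less_imp_le[OF \<epsilon>(1)] rip_nonneg[of ?y]]
          unfolding u distrib_left distrib_right by linarith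
      qed
      ultimately show "M *\<^sub>v x \<noteq> 0\<^sub>v (2 * d) \<and>
          rip (?H *\<^sub>v (M *\<^sub>v x)) (M *\<^sub>v x) \<le> (?t + \<epsilon>) * rip (M *\<^sub>v x) (M *\<^sub>v x)"
        unfolding Mx[OF x(1)] by blast
    qed (use j in auto)
    \<comment> \<open>The projection onto the unexcited slack component, which keeps the even
      indices.\<close>
    define M' where "M' = mat d (2 * d) (\<lambda>(i, k). if k = 2 * i then 1 else 0 :: complex)"
    have M': "M' \<in> carrier_mat d (2 * d)" by (simp add: M'_def)
    have M'x: "M' *\<^sub>v interleave x y = x" if x: "x \<in> carrier_vec d" for x y
    proof (rule eq_vecI)
      fix i assume "i < dim_vec x"
      then have i: "i < d" using x by simp
      have "(M' *\<^sub>v interleave x y) $ i = (\<Sum>k<2 * d. if k = 2 * i then interleave x y $ k else 0)"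
        unfolding mult_mat_vec_index[OF M' interleave_carrier[OF x] i]
        using i by (intro sum.cong) (auto simp: M'_def)
      also have "\<dots> = x $ i" using i interleave_index(1)[OF x i] by simp
      finally show "(M' *\<^sub>v interleave x y) $ i = x $ i" .
    qed (use M' x in simp)
    have lower: "?t \<le> ?h + \<epsilon>"
    proof (rule nth_eigenvalue_le[OF H gad T M'])
      fix u assume u: "u \<in> carrier_vec (2 * d)" "u \<noteq> 0\<^sub>v (2 * d)" and q: "rip (?H *\<^sub>v u) u \<le> ?h * rip u u"
      obtain x y where x: "x \<in> carrier_vec d" and y: "y \<in> carrier_vec d" and uxy: "u = interleave x y"
        using interleave_cases[OF u(1)] by metis
      let ?z = "y + g x"
      have z: "?z \<in> carrier_vec d" using y gc[OF x] by simp
      have y': "- g x \<in> carrier_vec d" using gc[OF x] by simp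
      \<comment> \<open>Splitting the slack component into the penalized deviation \<open>?z\<close>
        and the response to \<open>x\<close>, which is small.\<close>
      have "y = ?z + - g x" using y gc[OF x] by (intro eq_vecI) auto
      then have "rip y y \<le> 2 * rip ?z ?z + 2 * rip (- g x) (- g x)"
        using rip_add_le[OF z y'] by simp
      also have "rip (- g x) (- g x) = rip (g x) (g x)"
        using gc[OF x] y' by (simp add: rip_sum[of _ d])
      finally have yy: "rip y y \<le> 2 * rip ?z ?z + 2 * (k / l\<^sup>2 * rip x x)" using gg[OF x] by linarith
      have uu: "rip u u = rip x x + rip y y" unfolding uxy by (rule rip_interleave[OF x y x y])
      have Tx: "rip (T *\<^sub>v x) x \<le> (?h + \<epsilon>) * rip x x - (l\<^sup>2 * \<delta> - s) * rip ?z ?z"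
      proof -
        have "rip (T *\<^sub>v x) x + rip (A *\<^sub>v y) y + l\<^sup>2 * rip (D *\<^sub>v ?z) ?z \<le> ?h * rip x x + ?h * rip y y"
          using q form[OF x y, of ?z] uu unfolding uxy g_def by (simp add: algebra_simps)
        \<comment> \<open>The upper estimate already proved, with \<epsilon> at most 1, bounds the
          gadget eigenvalue by \<open>b + 1\<close>.\<close>
        moreover have "?h * rip y y \<le> (b + 1) * rip y y"
          using upper t \<epsilon> rip_nonneg[of y] by (intro mult_right_mono) auto
        moreover have "- (a * rip y y) \<le> rip (A *\<^sub>v y) y" using a(2)[OF y] by linarith
        moreover have "l\<^sup>2 * (\<delta> * rip ?z ?z) \<le> l\<^sup>2 * rip (D *\<^sub>v ?z) ?z"
          using \<delta>(2)[OF z] l2 by (intro mult_left_mono) auto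
        ultimately have "rip (T *\<^sub>v x) x \<le> ?h * rip x x + s / 2 * rip y y - l\<^sup>2 * \<delta> * rip ?z ?z"
          unfolding s2 distrib_right mult.assoc by linarith
        also have "s / 2 * rip y y \<le> s / 2 * (2 * rip ?z ?z + 2 * (k / l\<^sup>2 * rip x x))"
          using s yy by (intro mult_left_mono) auto
        also have "\<dots> = s * rip ?z ?z + s * (k / l\<^sup>2) * rip x x" by (simp add: algebra_simps)
        also have "s * (k / l\<^sup>2) * rip x x \<le> \<epsilon> * rip x x"
          using sk rip_nonneg by (rule mult_right_mono)
        finally show ?thesis by (simp add: algebra_simps)
      qed
      \<comment> \<open>The projection is injective on the vectors considered: if \<open>x\<close>
        vanished, the penalty would force \<open>?z\<close>, hence \<open>y\<close> and
        \<open>u\<close>, to vanish as well.\<close>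
      have "x \<noteq> 0\<^sub>v d"
      proof
        assume x0: "x = 0\<^sub>v d"
        then have "rip (T *\<^sub>v x) x = 0" "rip x x = 0" using x T by (auto simp: rip_sum[of _ d])
        then have "(l\<^sup>2 * \<delta> - s) * rip ?z ?z \<le> 0" using Tx by simp
        then have "rip ?z ?z \<le> 0" using s\<delta> by (simp add: mult_le_0_iff)
        then have "rip u u \<le> 0" using yy uu \<open>rip x x = 0\<close> by simp
        then show False using u rip_self_eq_0[OF u(1)] rip_nonneg[of u] by simp
      qed
      moreover have "rip (T *\<^sub>v x) x \<le> (?h + \<epsilon>) * rip x x"
        using Tx s\<delta> mult_nonneg_nonneg[of "l\<^sup>2 * \<delta> - s" "rip ?z ?z"] rip_nonneg[of ?z] by linarith
      ultimately show "M' *\<^sub>v u \<noteq> 0\<^sub>v d \<and> rip (T *\<^sub>v (M' *\<^sub>v u)) (M' *\<^sub>v u) \<le> (?h + \<epsilon>) * rip (M' *\<^sub>v u) (M' *\<^sub>v u)"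
        unfolding uxy M'x[OF x] by blast
    qed (use j in auto)
    show "\<bar>?h - ?t\<bar> \<le> \<epsilon>" using upper lower by linarith
  qed (fact C)
qed

section \<open>Kronecker products and Pauli operators\<close>

lemma kron_dim [simp]: "dim_row (kron A B) = dim_row A * dim_row B" "dim_col (kron A B) = dim_col A * dim_col B"
  by (simp_all add: kron_def)

lemma kron_index:
  assumes "i < dim_row A * dim_row B" "j < dim_col A * dim_col B"
  shows "kron A B $$ (i, j) = A $$ (i div dim_row B, j div dim_col B) * B $$ (i mod dim_row B, j mod dim_col B)"
  using assms by (simp add: kron_def)

lemma div_mod_less:
  assumes "(i :: nat) < a * b"
  shows "i div b < a" "i mod b < b"
proof -
  have "b > 0" using assms by (cases b) auto
  then show "i mod b < b" "i div b < a" using assms by (auto simp: less_mult_imp_div_less)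
qed

lemma sum_div_mod:
  fixes f :: "nat \<Rightarrow> nat \<Rightarrow> 'a::comm_monoid_add"
  shows "(\<Sum>k<a * b. f (k div b) (k mod b)) = (\<Sum>p<a. \<Sum>q<b. f p q)"
proof -
  \<comment> \<open>The indices \<open>p * b + q\<close> with fixed \<open>p\<close> form a block of
    length \<open>b\<close>; the blocks are then concatenated.\<close>
  have "(\<Sum>q<b. f p q) = (\<Sum>k = p * b..<p * b + b. f (k div b) (k mod b))" for p
    by (rule sum.reindex_bij_witness[of _ "\<lambda>k. k - p * b" "\<lambda>q. p * b + q"])
      (auto simp: div_mult_self3 dest: le_Suc_ex simp flip: le_iff_add)
  then show ?thesis by (simp add: sum.nat_group)
qed

text \<open>The mixed product rule: splitting the summation index into quotient and remainder makes
  the double sum factor.\<close>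

lemma kron_mult:
  assumes A: "A \<in> carrier_mat a b" and B: "B \<in> carrier_mat a' b'"
    and C: "C \<in> carrier_mat b c" and D: "D \<in> carrier_mat b' c'"
  shows "kron A B * kron C D = kron (A * C) (B * D)"
proof (rule eq_matI)
  note AB = kron_carrier[OF A B] and CD = kron_carrier[OF C D]
  fix i j assume "i < dim_row (kron (A * C) (B * D))" "j < dim_col (kron (A * C) (B * D))"
  then have i: "i < a * a'" and j: "j < c * c'" using assms by auto
  note i' = div_mod_less[OF i] and j' = div_mod_less[OF j]
  have "(kron A B * kron C D) $$ (i, j) = (\<Sum>k<b * b'. kron A B $$ (i, k) * kron C D $$ (k, j))"
    by (rule mult_mat_index[OF AB CD i j])
  also have "\<dots> = (\<Sum>k<b * b'. (A $$ (i div a', k div b') * C $$ (k div b', j div c')) *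
      (B $$ (i mod a', k mod b') * D $$ (k mod b', j mod c')))"
    using assms i j by (intro sum.cong) (auto simp: kron_index)
  also have "\<dots> = (\<Sum>p<b. \<Sum>q<b'. (A $$ (i div a', p) * C $$ (p, j div c')) *
      (B $$ (i mod a', q) * D $$ (q, j mod c')))"
    by (rule sum_div_mod)
  also have "\<dots> = (A * C) $$ (i div a', j div c') * (B * D) $$ (i mod a', j mod c')"
    unfolding mult_mat_index[OF A C i'(1) j'(1)] mult_mat_index[OF B D i'(2) j'(2)] by (rule sum_product[symmetric])
  also have "\<dots> = kron (A * C) (B * D) $$ (i, j)"
    using assms i j by (simp add: kron_index)
  finally show "(kron A B * kron C D) $$ (i, j) = kron (A * C) (B * D) $$ (i, j)" .
qed (use assms in auto)

text \<open>Both bracketings read an index as the same three digits in mixed radix.\<close>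

lemma kron_assoc: "kron (kron A B) C = kron A (kron B C)"
proof (rule eq_matI)
  fix i j assume "i < dim_row (kron A (kron B C))" "j < dim_col (kron A (kron B C))"
  then have i: "i < dim_row A * dim_row B * dim_row C" and j: "j < dim_col A * dim_col B * dim_col C"
    by (auto simp: mult.assoc)
  have mod_div: "k mod (p * q) div q = k div q mod p" "k mod (p * q) mod q = k mod q" for k p q :: nat
    by (cases "q = 0"; simp add: mod_mult2_eq mult.commute[of p])+
  have div: "k div (p * q) = k div q div p" for k p q :: nat by (simp add: div_mult2_eq mult.commute[of p])
  have "i mod (dim_row B * dim_row C) < dim_row B * dim_row C"
    "j mod (dim_col B * dim_col C) < dim_col B * dim_col C"
    using div_mod_less(2)[of i "dim_row A"] div_mod_less(2)[of j "dim_col A"] i j by (auto simp: mult.assoc)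
  then show "kron (kron A B) C $$ (i, j) = kron A (kron B C) $$ (i, j)"
    using i j div_mod_less[OF i] div_mod_less[OF j]
    by (simp add: kron_index mult.assoc mod_div div)
qed (auto simp: mult.assoc)

lemma kron_add_left:
  assumes "A \<in> carrier_mat r c" "B \<in> carrier_mat r c"
  shows "kron (A + B) P = kron A P + kron B P"
proof (rule eq_matI)
  fix i j assume "i < dim_row (kron A P + kron B P)" "j < dim_col (kron A P + kron B P)"
  then have i: "i < r * dim_row P" and j: "j < c * dim_col P" using assms by auto
  then show "kron (A + B) P $$ (i, j) = (kron A P + kron B P) $$ (i, j)"
    using assms div_mod_less[OF i] div_mod_less[OF j] by (simp add: kron_index algebra_simps)
qed (use assms in auto)

lemma kron_smult_left: "kron (k \<cdot>\<^sub>m A) P = k \<cdot>\<^sub>m kron A P"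
proof (rule eq_matI)
  fix i j assume "i < dim_row (k \<cdot>\<^sub>m kron A P)" "j < dim_col (k \<cdot>\<^sub>m kron A P)"
  then have i: "i < dim_row A * dim_row P" and j: "j < dim_col A * dim_col P" by auto
  then show "kron (k \<cdot>\<^sub>m A) P $$ (i, j) = (k \<cdot>\<^sub>m kron A P) $$ (i, j)"
    using div_mod_less[OF i] div_mod_less[OF j] by (simp add: kron_index)
qed auto

lemma kron_one_one: "kron (1\<^sub>m a) (1\<^sub>m b) = 1\<^sub>m (a * b)"
proof (rule eq_matI)
  fix i j assume "i < dim_row (1\<^sub>m (a * b) :: complex mat)" "j < dim_col (1\<^sub>m (a * b) :: complex mat)"
  then have i: "i < a * b" and j: "j < a * b" by auto
  have "i div b = j div b \<and> i mod b = j mod b \<longleftrightarrow> i = j" by (metis div_mult_mod_eq)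
  then show "kron (1\<^sub>m a) (1\<^sub>m b) $$ (i, j) = 1\<^sub>m (a * b) $$ (i, j)"
    using i j div_mod_less[OF i] div_mod_less[OF j] by (auto simp: kron_index)
qed auto

lemma kron_one1_left: "kron (1\<^sub>m 1) P = P"
  by (rule eq_matI) (auto simp: kron_index)

lemma kron_one1_right: "kron P (1\<^sub>m 1) = P"
  by (rule eq_matI) (auto simp: kron_index)

lemma adjoint_kron: "mat_adjoint (kron A B) = kron (mat_adjoint A) (mat_adjoint B)"
proof (rule eq_matI)
  fix i j assume "i < dim_row (kron (mat_adjoint A) (mat_adjoint B))" "j < dim_col (kron (mat_adjoint A) (mat_adjoint B))"
  then have i: "i < dim_col A * dim_col B" and j: "j < dim_row A * dim_row B" by auto
  then show "mat_adjoint (kron A B) $$ (i, j) = kron (mat_adjoint A) (mat_adjoint B) $$ (i, j)"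
    using div_mod_less[OF i] div_mod_less[OF j] by (simp add: kron_index)
qed auto

lemma hermitian_kron: "hermitian_mat A \<Longrightarrow> hermitian_mat B \<Longrightarrow> hermitian_mat (kron A B)"
  by (simp add: hermitian_mat_def adjoint_kron)

lemma hermitian_one: "hermitian_mat (1\<^sub>m n)"
  by (simp add: hermitian_mat_def)

lemma hermitian_iff:
  assumes "A \<in> carrier_mat n n"
  shows "hermitian_mat A \<longleftrightarrow> (\<forall>i<n. \<forall>j<n. cnj (A $$ (j, i)) = A $$ (i, j))"
  using assms unfolding hermitian_mat_def mat_eq_iff by auto

lemma hermitian_add:
  assumes "A \<in> carrier_mat n n" "B \<in> carrier_mat n n" "hermitian_mat A" "hermitian_mat B"
  shows "hermitian_mat (A + B)"
  using assms by (simp add: hermitian_iff[of _ n])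

lemma hermitian_smult:
  assumes "A \<in> carrier_mat n n" "hermitian_mat A"
  shows "hermitian_mat (complex_of_real c \<cdot>\<^sub>m A)"
  using assms by (simp add: hermitian_iff[of _ n])

lemma hermitian_mult_commute:
  assumes "A \<in> carrier_mat n n" "B \<in> carrier_mat n n" "hermitian_mat A" "hermitian_mat B" "A * B = B * A"
  shows "hermitian_mat (A * B)"
  using assms adjoint_mult[OF assms(1,2)] by (simp add: hermitian_mat_def)

lemma hermitian_pauli: "hermitian_mat pauliX" "hermitian_mat pauliY" "hermitian_mat pauliZ" "hermitian_mat ketbra1"
  unfolding hermitian_iff[OF pauli_carrier(1)] hermitian_iff[OF pauli_carrier(2)]
    hermitian_iff[OF pauli_carrier(3)] hermitian_iff[OF pauli_carrier(4)]
  by (auto simp: less_2_cases_iff)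

section \<open>Operators on a single qubit\<close>

lemma on_qubit_carrier:
  assumes "P \<in> carrier_mat 2 2" "i < m"
  shows "on_qubit m P i \<in> carrier_mat (2 ^ m) (2 ^ m)"
proof -
  obtain k where "m = i + Suc k" using assms(2) less_imp_Suc_add by force
  then have "(2::nat) ^ m = 2 ^ i * 2 * 2 ^ (m - 1 - i)"
    by (simp add: power_add)
  then show ?thesis
    unfolding on_qubit_def using kron_carrier[OF kron_carrier[OF one_carrier_mat assms(1)] one_carrier_mat] by metis
qed

lemma hermitian_on_qubit: "hermitian_mat P \<Longrightarrow> hermitian_mat (on_qubit m P i)"
  unfolding on_qubit_def by (intro hermitian_kron hermitian_one)

lemma on_qubit_Suc:
  assumes "i < n"
  shows "on_qubit (n + 1) P i = kron (on_qubit n P i) (1\<^sub>m 2)"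
proof -
  have "n + 1 - 1 - i = Suc (n - 1 - i)" using assms by simp
  then have "(1\<^sub>m (2 ^ (n + 1 - 1 - i)) :: complex mat) = kron (1\<^sub>m (2 ^ (n - 1 - i))) (1\<^sub>m 2)"
    by (simp add: kron_one_one mult.commute)
  then show ?thesis unfolding on_qubit_def by (simp add: kron_assoc)
qed

lemma on_qubit_last: "on_qubit (n + 1) P n = kron (1\<^sub>m (2 ^ n)) P"
  unfolding on_qubit_def by (simp add: kron_one1_right[unfolded One_nat_def])

lemma on_qubit_0:
  assumes "n \<ge> 2"
  shows "on_qubit n P 0 = kron (kron P (1\<^sub>m 2)) (1\<^sub>m (2 ^ (n - 2)))"
proof -
  have "n - 1 = Suc (n - 2)" using assms by simp
  then show ?thesis
    unfolding on_qubit_def by (simp add: kron_assoc kron_one_one kron_one1_left[unfolded One_nat_def])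
qed

lemma on_qubit_1: "on_qubit n P 1 = kron (kron (1\<^sub>m 2) P) (1\<^sub>m (2 ^ (n - 2)))"
proof -
  have "n - 1 - 1 = n - 2" by simp
  then show ?thesis unfolding on_qubit_def by (simp only: power_one_right)
qed

text \<open>Both operators are written over the same five tensor factors: before \<open>i\<close>,
  at \<open>i\<close>, between, at \<open>j\<close>, after. In each factor at least one of them is
  the identity.\<close>

lemma on_qubit_commute:
  assumes P: "P \<in> carrier_mat 2 2" and Q: "Q \<in> carrier_mat 2 2" and ij: "i < j" "j < m"
  shows "on_qubit m P i * on_qubit m Q j = on_qubit m Q j * on_qubit m P i"
proof -
  let ?k = "j - 1 - i" and ?r = "m - 1 - j"
  have "m - 1 - i = ?k + Suc ?r" using ij by simp
  then have r: "(2::nat) ^ (m - 1 - i) = 2 ^ ?k * (2 * 2 ^ ?r)" by (simp only: power_add power_Suc)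
  have "j = i + Suc ?k" using ij by simp
  then have j: "(2::nat) ^ j = 2 ^ i * (2 * 2 ^ ?k)" by (metis power_Suc power_add)
  let ?a = "1\<^sub>m (2 ^ i) :: complex mat" and ?b = "1\<^sub>m 2 :: complex mat" and ?c = "1\<^sub>m (2 ^ ?k) :: complex mat"
    and ?d = "1\<^sub>m (2 ^ ?r) :: complex mat"
  have Pi: "on_qubit m P i = kron ?a (kron P (kron ?c (kron ?b ?d)))"
    unfolding on_qubit_def r kron_one_one kron_assoc ..
  have Qj: "on_qubit m Q j = kron ?a (kron ?b (kron ?c (kron Q ?d)))"
    unfolding on_qubit_def j kron_one_one[symmetric] kron_assoc ..
  have c: "kron P (kron ?c (kron ?b ?d)) \<in> carrier_mat (2 * (2 ^ ?k * (2 * 2 ^ ?r))) (2 * (2 ^ ?k * (2 * 2 ^ ?r)))"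
      "kron ?b (kron ?c (kron Q ?d)) \<in> carrier_mat (2 * (2 ^ ?k * (2 * 2 ^ ?r))) (2 * (2 ^ ?k * (2 * 2 ^ ?r)))"
      "kron ?c (kron ?b ?d) \<in> carrier_mat (2 ^ ?k * (2 * 2 ^ ?r)) (2 ^ ?k * (2 * 2 ^ ?r))"
      "kron ?c (kron Q ?d) \<in> carrier_mat (2 ^ ?k * (2 * 2 ^ ?r)) (2 ^ ?k * (2 * 2 ^ ?r))"
      "kron ?b ?d \<in> carrier_mat (2 * 2 ^ ?r) (2 * 2 ^ ?r)" "kron Q ?d \<in> carrier_mat (2 * 2 ^ ?r) (2 * 2 ^ ?r)"
    by (intro kron_carrier one_carrier_mat P Q)+
  note o = one_carrier_mat
  show ?thesis
    unfolding Pi Qj kron_mult[OF o c(1) o c(2)] kron_mult[OF o c(2) o c(1)] kron_mult[OF P c(3) o c(4)]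
      kron_mult[OF o c(4) P c(3)] kron_mult[OF o c(5) o c(6)] kron_mult[OF o c(6) o c(5)]
      kron_mult[OF o o Q o] kron_mult[OF Q o o o]
    using P Q by simp
qed

lemma kron_add_right:
  assumes "P \<in> carrier_mat r c" "Q \<in> carrier_mat r c"
  shows "kron A (P + Q) = kron A P + kron A Q"
proof (rule eq_matI)
  fix i j assume "i < dim_row (kron A P + kron A Q)" "j < dim_col (kron A P + kron A Q)"
  then have i: "i < dim_row A * r" and j: "j < dim_col A * c" using assms by auto
  then show "kron A (P + Q) $$ (i, j) = (kron A P + kron A Q) $$ (i, j)"
    using assms div_mod_less[OF i] div_mod_less[OF j] by (simp add: kron_index algebra_simps)
qed (use assms in auto)

lemma kron_smult_right: "kron A (k \<cdot>\<^sub>m P) = k \<cdot>\<^sub>m kron A P"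
proof (rule eq_matI)
  fix i j assume "i < dim_row (k \<cdot>\<^sub>m kron A P)" "j < dim_col (k \<cdot>\<^sub>m kron A P)"
  then have i: "i < dim_row A * dim_row P" and j: "j < dim_col A * dim_col P" by auto
  then show "kron A (k \<cdot>\<^sub>m P) $$ (i, j) = (k \<cdot>\<^sub>m kron A P) $$ (i, j)"
    using div_mod_less[OF i] div_mod_less[OF j] by (simp add: kron_index)
qed auto

section \<open>Entrywise family sums and the ZZXX normal form\<close>

lemma mat_family_sum_carrier [simp]: "mat_family_sum d F I \<in> carrier_mat d d"
  by (simp add: mat_family_sum_def)

lemma mat_family_sum_smult_index:
  assumes "\<And>i. i \<in> I \<Longrightarrow> F i \<in> carrier_mat d d" "r < d" "s < d"
  shows "mat_family_sum d (\<lambda>i. k i \<cdot>\<^sub>m F i) I $$ (r, s) = (\<Sum>i\<in>I. k i * F i $$ (r, s))"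
  using assms by (simp add: mat_family_sum_def) (intro sum.cong refl, auto dest!: assms(1))

text \<open>Connects the entrywise sum with matrix addition: adding an index adds one summand, so
  additive closure of \<open>Q\<close> carries over to the whole family.\<close>

lemma mat_family_sum_induct:
  assumes "finite I" "\<And>i. i \<in> I \<Longrightarrow> F i \<in> carrier_mat d d" "\<And>i. i \<in> I \<Longrightarrow> Q (F i)" "Q (0\<^sub>m d d)"
    and "\<And>A B. A \<in> carrier_mat d d \<Longrightarrow> B \<in> carrier_mat d d \<Longrightarrow> Q A \<Longrightarrow> Q B \<Longrightarrow> Q (A + B)"
  shows "Q (mat_family_sum d F I)"
  using assms(1-3)
proof (induct I rule: finite_induct)
  case empty
  have "mat_family_sum d F {} = 0\<^sub>m d d" by (intro eq_matI) (auto simp: mat_family_sum_def)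
  then show ?case using assms(4) by simp
next
  case (insert a I)
  have "mat_family_sum d F (insert a I) = F a + mat_family_sum d F I"
    using insert.hyps insert.prems(1)[of a] by (intro eq_matI) (auto simp: mat_family_sum_def)
  then show ?case using insert assms(5) by simp
qed

lemma finite_qubit_pairs [simp]: "finite (qubit_pairs m)"
  by (rule finite_subset[of _ "{..<m} \<times> {..<m}"]) (auto simp: qubit_pairs_def)

definition pair_on :: "nat \<Rightarrow> complex mat \<Rightarrow> nat \<times> nat \<Rightarrow> complex mat" where
  "pair_on m P p = on_qubit m P (fst p) * on_qubit m P (snd p)"

lemma pair_on_carrier:
  assumes "P \<in> carrier_mat 2 2" "p \<in> qubit_pairs m"
  shows "pair_on m P p \<in> carrier_mat (2 ^ m) (2 ^ m)"
  using assms mult_carrier_mat[OF on_qubit_carrier on_qubit_carrier]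
  by (auto simp: pair_on_def qubit_pairs_def)

text \<open>The expression in \<open>zzxx_form\<close> as a function of its coefficients, with the
  couplings indexed by pairs. Reality of the coefficients is imposed in
  \<open>zzxx_form_iff\<close>.\<close>

definition zzxx_mat ::
  "nat \<Rightarrow> complex \<Rightarrow> (nat \<Rightarrow> complex) \<Rightarrow> (nat \<Rightarrow> complex) \<Rightarrow> (nat \<times> nat \<Rightarrow> complex) \<Rightarrow> (nat \<times> nat \<Rightarrow> complex) \<Rightarrow> complex mat"
  where "zzxx_mat m c h D J K = c \<cdot>\<^sub>m 1\<^sub>m (2 ^ m)
    + mat_family_sum (2 ^ m) (\<lambda>i. h i \<cdot>\<^sub>m Z_on m i) {..<m}
    + mat_family_sum (2 ^ m) (\<lambda>i. D i \<cdot>\<^sub>m X_on m i) {..<m}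
    + mat_family_sum (2 ^ m) (\<lambda>p. J p \<cdot>\<^sub>m pair_on m pauliZ p) (qubit_pairs m)
    + mat_family_sum (2 ^ m) (\<lambda>p. K p \<cdot>\<^sub>m pair_on m pauliX p) (qubit_pairs m)"

lemma zzxx_form_iff:
  "zzxx_form m H \<longleftrightarrow> (\<exists>(c :: real) (h :: nat \<Rightarrow> real) (D :: nat \<Rightarrow> real) (J :: nat \<times> nat \<Rightarrow> real) (K :: nat \<times> nat \<Rightarrow> real).
    H = zzxx_mat m (complex_of_real c) (\<lambda>i. complex_of_real (h i)) (\<lambda>i. complex_of_real (D i))
      (\<lambda>p. complex_of_real (J p)) (\<lambda>p. complex_of_real (K p)))"
  (is "_ \<longleftrightarrow> ?R")
proof
  assume "zzxx_form m H"
  then obtain c h D J K where "H = zzxx_mat m (complex_of_real c) (\<lambda>i. complex_of_real (h i))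
      (\<lambda>i. complex_of_real (D i)) (\<lambda>p. complex_of_real (J (fst p) (snd p))) (\<lambda>p. complex_of_real (K (fst p) (snd p)))"
    unfolding zzxx_form_def zzxx_mat_def pair_on_def case_prod_beta' by blast
  then show ?R by (intro exI)
next
  assume ?R
  then obtain c h D J K where H: "H = zzxx_mat m (complex_of_real c) (\<lambda>i. complex_of_real (h i))
      (\<lambda>i. complex_of_real (D i)) (\<lambda>p. complex_of_real (J p)) (\<lambda>p. complex_of_real (K p))" by blast
  show "zzxx_form m H"
    unfolding zzxx_form_def
    by (rule exI[of _ c], rule exI[of _ h], rule exI[of _ D], rule exI[of _ "\<lambda>i j. J (i, j)"],
        rule exI[of _ "\<lambda>i j. K (i, j)"]) (simp add: H zzxx_mat_def pair_on_def case_prod_beta')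
qed

lemma zzxx_mat_carrier [simp]: "zzxx_mat m c h D J K \<in> carrier_mat (2 ^ m) (2 ^ m)"
  by (simp add: zzxx_mat_def)

lemma zzxx_form_carrier: "zzxx_form m H \<Longrightarrow> H \<in> carrier_mat (2 ^ m) (2 ^ m)"
  by (auto simp: zzxx_form_iff)

lemma zzxx_mat_index:
  assumes "r < 2 ^ m" "s < 2 ^ m"
  shows "zzxx_mat m c h D J K $$ (r, s) = c * 1\<^sub>m (2 ^ m) $$ (r, s)
    + (\<Sum>i<m. h i * Z_on m i $$ (r, s)) + (\<Sum>i<m. D i * X_on m i $$ (r, s))
    + (\<Sum>p\<in>qubit_pairs m. J p * pair_on m pauliZ p $$ (r, s))
    + (\<Sum>p\<in>qubit_pairs m. K p * pair_on m pauliX p $$ (r, s))"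
proof -
  have "mat_family_sum (2 ^ m) (\<lambda>i. k i \<cdot>\<^sub>m on_qubit m P i) {..<m} $$ (r, s) = (\<Sum>i<m. k i * on_qubit m P i $$ (r, s))"
    if "P \<in> carrier_mat 2 2" for k P
    using assms that by (intro mat_family_sum_smult_index on_qubit_carrier) auto
  moreover have "mat_family_sum (2 ^ m) (\<lambda>p. k p \<cdot>\<^sub>m pair_on m P p) (qubit_pairs m) $$ (r, s) =
      (\<Sum>p\<in>qubit_pairs m. k p * pair_on m P p $$ (r, s))"
    if "P \<in> carrier_mat 2 2" for k P
    using assms that by (intro mat_family_sum_smult_index pair_on_carrier) auto
  moreover have "dim_row (mat_family_sum (2 ^ m) F I) = 2 ^ m" "dim_col (mat_family_sum (2 ^ m) F I) = 2 ^ m"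
    for F and I :: "'i set" by (simp_all add: mat_family_sum_def)
  ultimately show ?thesis
    using assms unfolding zzxx_mat_def by (simp add: mat_family_sum_def)
qed

lemma zzxx_form_add:
  assumes "zzxx_form m A" "zzxx_form m B"
  shows "zzxx_form m (A + B)"
proof -
  obtain c h D J K where A: "A = zzxx_mat m (complex_of_real c) (\<lambda>i. complex_of_real (h i))
      (\<lambda>i. complex_of_real (D i)) (\<lambda>p. complex_of_real (J p)) (\<lambda>p. complex_of_real (K p))"
    using assms(1) unfolding zzxx_form_iff by blast
  obtain c' h' D' J' K' where B: "B = zzxx_mat m (complex_of_real c') (\<lambda>i. complex_of_real (h' i))
      (\<lambda>i. complex_of_real (D' i)) (\<lambda>p. complex_of_real (J' p)) (\<lambda>p. complex_of_real (K' p))"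
    using assms(2) unfolding zzxx_form_iff by blast
  have "A + B = zzxx_mat m (complex_of_real (c + c')) (\<lambda>i. complex_of_real (h i + h' i))
      (\<lambda>i. complex_of_real (D i + D' i)) (\<lambda>p. complex_of_real (J p + J' p)) (\<lambda>p. complex_of_real (K p + K' p))"
    (is "_ = ?C")
  proof (rule eq_matI)
    fix r s assume "r < dim_row ?C" "s < dim_col ?C"
    then have "r < 2 ^ m" "s < 2 ^ m" using carrier_matD[OF zzxx_mat_carrier] by metis+
    then show "(A + B) $$ (r, s) = ?C $$ (r, s)"
      unfolding A B using carrier_matD[OF zzxx_mat_carrier]
      by (simp add: zzxx_mat_index sum.distrib distrib_right del: index_one_mat(1))
  qed (use carrier_matD[OF zzxx_mat_carrier] in \<open>auto simp: B\<close>)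
  then show ?thesis unfolding zzxx_form_iff by (intro exI)
qed

lemma zzxx_form_smult:
  assumes "zzxx_form m A"
  shows "zzxx_form m (complex_of_real k \<cdot>\<^sub>m A)"
proof -
  obtain c h D J K where A: "A = zzxx_mat m (complex_of_real c) (\<lambda>i. complex_of_real (h i))
      (\<lambda>i. complex_of_real (D i)) (\<lambda>p. complex_of_real (J p)) (\<lambda>p. complex_of_real (K p))"
    using assms(1) unfolding zzxx_form_iff by blast
  have "complex_of_real k \<cdot>\<^sub>m A = zzxx_mat m (complex_of_real (k * c)) (\<lambda>i. complex_of_real (k * h i))
      (\<lambda>i. complex_of_real (k * D i)) (\<lambda>p. complex_of_real (k * J p)) (\<lambda>p. complex_of_real (k * K p))"
    (is "_ = ?C")
  proof (rule eq_matI)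
    fix r s assume "r < dim_row ?C" "s < dim_col ?C"
    then have "r < 2 ^ m" "s < 2 ^ m" using carrier_matD[OF zzxx_mat_carrier] by metis+
    then show "(complex_of_real k \<cdot>\<^sub>m A) $$ (r, s) = ?C $$ (r, s)"
      unfolding A using carrier_matD[OF zzxx_mat_carrier]
      by (simp add: zzxx_mat_index sum_distrib_left distrib_left mult.assoc del: index_one_mat(1))
  qed (use carrier_matD[OF zzxx_mat_carrier] in \<open>auto simp: A\<close>)
  then show ?thesis unfolding zzxx_form_iff by (intro exI)
qed

lemma zzxx_form_intro:
  assumes "H \<in> carrier_mat (2 ^ m) (2 ^ m)"
    and "\<And>r s. r < 2 ^ m \<Longrightarrow> s < 2 ^ m \<Longrightarrow> H $$ (r, s) =
      zzxx_mat m (complex_of_real c) (\<lambda>i. complex_of_real (h i)) (\<lambda>i. complex_of_real (D i))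
      (\<lambda>p. complex_of_real (J p)) (\<lambda>p. complex_of_real (K p)) $$ (r, s)"
  shows "zzxx_form m H"
proof -
  have "H = zzxx_mat m (complex_of_real c) (\<lambda>i. complex_of_real (h i)) (\<lambda>i. complex_of_real (D i))
      (\<lambda>p. complex_of_real (J p)) (\<lambda>p. complex_of_real (K p))"
    by (rule eq_matI) (use assms carrier_matD[OF zzxx_mat_carrier] in auto)
  then show ?thesis unfolding zzxx_form_iff by blast
qed

section \<open>Generators of the ZZXX form\<close>

lemma zzxx_form_one: "zzxx_form m (1\<^sub>m (2 ^ m))"
  by (rule zzxx_form_intro[where c = 1 and h = "\<lambda>_. 0" and D = "\<lambda>_. 0" and J = "\<lambda>_. 0" and K = "\<lambda>_. 0"])
    (auto simp: zzxx_mat_index)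

lemma zzxx_form_Z:
  assumes "a < m"
  shows "zzxx_form m (Z_on m a)"
  by (rule zzxx_form_intro[where c = 0 and h = "\<lambda>i. of_bool (i = a)" and D = "\<lambda>_. 0" and J = "\<lambda>_. 0" and K = "\<lambda>_. 0"])
    (use assms in \<open>auto simp: zzxx_mat_index on_qubit_carrier of_bool_def if_distrib[of "\<lambda>x. x * _"]
      if_distrib[of complex_of_real] cong: if_cong\<close>)

lemma zzxx_form_X:
  assumes "a < m"
  shows "zzxx_form m (X_on m a)"
  by (rule zzxx_form_intro[where c = 0 and h = "\<lambda>_. 0" and D = "\<lambda>i. of_bool (i = a)" and J = "\<lambda>_. 0" and K = "\<lambda>_. 0"])
    (use assms in \<open>auto simp: zzxx_mat_index on_qubit_carrier of_bool_def if_distrib[of "\<lambda>x. x * _"]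
      if_distrib[of complex_of_real] cong: if_cong\<close>)

lemma zzxx_form_ZZ:
  assumes "a < b" "b < m"
  shows "zzxx_form m (Z_on m a * Z_on m b)"
proof -
  have p: "(a, b) \<in> qubit_pairs m" using assms by (simp add: qubit_pairs_def)
  have "zzxx_form m (pair_on m pauliZ (a, b))"
    by (rule zzxx_form_intro[where c = 0 and h = "\<lambda>_. 0" and D = "\<lambda>_. 0" and J = "\<lambda>p. of_bool (p = (a, b))" and K = "\<lambda>_. 0"])
      (use p in \<open>auto simp: zzxx_mat_index pair_on_carrier of_bool_def if_distrib[of "\<lambda>x. x * _"]
        if_distrib[of complex_of_real] cong: if_cong\<close>)
  then show ?thesis by (simp add: pair_on_def)
qed

lemma zzxx_form_XX:
  assumes "a < b" "b < m"
  shows "zzxx_form m (X_on m a * X_on m b)"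
proof -
  have p: "(a, b) \<in> qubit_pairs m" using assms by (simp add: qubit_pairs_def)
  have "zzxx_form m (pair_on m pauliX (a, b))"
    by (rule zzxx_form_intro[where c = 0 and h = "\<lambda>_. 0" and D = "\<lambda>_. 0" and J = "\<lambda>_. 0" and K = "\<lambda>p. of_bool (p = (a, b))"])
      (use p in \<open>auto simp: zzxx_mat_index pair_on_carrier of_bool_def if_distrib[of "\<lambda>x. x * _"]
        if_distrib[of complex_of_real] cong: if_cong\<close>)
  then show ?thesis by (simp add: pair_on_def)
qed

text \<open>Operators of ZZXX form are the real span of the identity and the four kinds of Pauli
  terms, so a property stable under sums and real multiples need only be checked on these.\<close>

lemma zzxx_form_induct:
  assumes "zzxx_form m H"
    and one: "Q (1\<^sub>m (2 ^ m))"
    and Z: "\<And>i. i < m \<Longrightarrow> Q (Z_on m i)" and X: "\<And>i. i < m \<Longrightarrow> Q (X_on m i)"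
    and ZZ: "\<And>i j. i < j \<Longrightarrow> j < m \<Longrightarrow> Q (Z_on m i * Z_on m j)"
    and XX: "\<And>i j. i < j \<Longrightarrow> j < m \<Longrightarrow> Q (X_on m i * X_on m j)"
    and add: "\<And>A B. A \<in> carrier_mat (2 ^ m) (2 ^ m) \<Longrightarrow> B \<in> carrier_mat (2 ^ m) (2 ^ m) \<Longrightarrow> Q A \<Longrightarrow> Q B \<Longrightarrow> Q (A + B)"
    and smult: "\<And>A (c :: real). A \<in> carrier_mat (2 ^ m) (2 ^ m) \<Longrightarrow> Q A \<Longrightarrow> Q (complex_of_real c \<cdot>\<^sub>m A)"
  shows "Q H"
proof -
  obtain c h D J K where H: "H = zzxx_mat m (complex_of_real c) (\<lambda>i. complex_of_real (h i))
      (\<lambda>i. complex_of_real (D i)) (\<lambda>p. complex_of_real (J p)) (\<lambda>p. complex_of_real (K p))"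
    using assms(1) unfolding zzxx_form_iff by blast
  have "complex_of_real 0 \<cdot>\<^sub>m 1\<^sub>m (2 ^ m) = (0\<^sub>m (2 ^ m) (2 ^ m) :: complex mat)" by (intro eq_matI) auto
  \<comment> \<open>The empty sum is covered by scaling the identity with 0.\<close>
  then have zero: "Q (0\<^sub>m (2 ^ m) (2 ^ m))" using smult[OF one_carrier_mat one, of 0] by simp
  have single: "Q (mat_family_sum (2 ^ m) (\<lambda>i. complex_of_real (k i) \<cdot>\<^sub>m on_qubit m P i) {..<m})"
    if "P \<in> carrier_mat 2 2" "\<And>i. i < m \<Longrightarrow> Q (on_qubit m P i)" for k P
    using that
    by (intro mat_family_sum_induct[where Q = Q] zero smult add) (auto simp: on_qubit_carrier)
  have pair: "Q (mat_family_sum (2 ^ m) (\<lambda>p. complex_of_real (k p) \<cdot>\<^sub>m pair_on m P p) (qubit_pairs m))"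
    if "P \<in> carrier_mat 2 2" "\<And>i j. i < j \<Longrightarrow> j < m \<Longrightarrow> Q (on_qubit m P i * on_qubit m P j)" for k P
    using that
    by (intro mat_family_sum_induct[where Q = Q] zero smult add)
      (auto simp: pair_on_carrier, auto simp: pair_on_def qubit_pairs_def)
  show ?thesis
    unfolding H zzxx_mat_def
    by (intro add smult one single pair Z X ZZ XX) auto
qed

text \<open>A pair term is a product of two Hermitian operators on different qubits, which
  commute.\<close>

lemma zzxx_form_hermitian:
  assumes "zzxx_form m H"
  shows "hermitian_mat H"
  using assms
proof (rule zzxx_form_induct)
  show "hermitian_mat (Z_on m i * Z_on m j)" if "i < j" "j < m" for i j
    using that
    by (intro hermitian_mult_commute[of _ "2 ^ m"] on_qubit_carrier hermitian_on_qubit hermitian_pauli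
        pauli_carrier on_qubit_commute) auto
  show "hermitian_mat (X_on m i * X_on m j)" if "i < j" "j < m" for i j
    using that
    by (intro hermitian_mult_commute[of _ "2 ^ m"] on_qubit_carrier hermitian_on_qubit hermitian_pauli
        pauli_carrier on_qubit_commute) auto
qed (auto intro: hermitian_one hermitian_on_qubit hermitian_pauli hermitian_add hermitian_smult)

section \<open>Appending the slack qubit\<close>

lemma on_qubit_mult_Suc:
  assumes "P \<in> carrier_mat 2 2" "Q \<in> carrier_mat 2 2" "i < m" "j < m"
  shows "kron (on_qubit m P i * on_qubit m Q j) (1\<^sub>m 2) = on_qubit (m + 1) P i * on_qubit (m + 1) Q j"
  unfolding on_qubit_Suc[OF assms(3)] on_qubit_Suc[OF assms(4)]
    kron_mult[OF on_qubit_carrier[OF assms(1,3)] one_carrier_mat on_qubit_carrier[OF assms(2,4)] one_carrier_mat]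
  by simp

text \<open>With an idle slack qubit each generator becomes the same generator on one more
  qubit.\<close>

lemma zzxx_form_kron_one:
  assumes "zzxx_form m H"
  shows "zzxx_form (m + 1) (kron H (1\<^sub>m 2))"
  using assms
proof (rule zzxx_form_induct)
  show "zzxx_form (m + 1) (kron (1\<^sub>m (2 ^ m)) (1\<^sub>m 2))"
    using zzxx_form_one[of "m + 1"] by (simp add: kron_one_one mult.commute)
  show "zzxx_form (m + 1) (kron (A + B) (1\<^sub>m 2))"
    if "A \<in> carrier_mat (2 ^ m) (2 ^ m)" "B \<in> carrier_mat (2 ^ m) (2 ^ m)"
      "zzxx_form (m + 1) (kron A (1\<^sub>m 2))" "zzxx_form (m + 1) (kron B (1\<^sub>m 2))" for A B
    using that by (simp add: kron_add_left zzxx_form_add)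
  show "zzxx_form (m + 1) (kron (Z_on m i) (1\<^sub>m 2))" if "i < m" for i
    using that zzxx_form_Z[of i "m + 1"] by (simp add: on_qubit_Suc[simplified])
  show "zzxx_form (m + 1) (kron (X_on m i) (1\<^sub>m 2))" if "i < m" for i
    using that zzxx_form_X[of i "m + 1"] by (simp add: on_qubit_Suc[simplified])
  show "zzxx_form (m + 1) (kron (Z_on m i * Z_on m j) (1\<^sub>m 2))" if "i < j" "j < m" for i j
    using that zzxx_form_ZZ[of i j "m + 1"] by (subst on_qubit_mult_Suc) auto
  show "zzxx_form (m + 1) (kron (X_on m i * X_on m j) (1\<^sub>m 2))" if "i < j" "j < m" for i j
    using that zzxx_form_XX[of i j "m + 1"] by (subst on_qubit_mult_Suc) auto
qed (simp add: kron_smult_left zzxx_form_smult)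

text \<open>A one-qubit operator tensored with a slack operator is a two-body term between qubit
  \<open>i\<close> and the slack qubit \<open>m\<close>; for equal Paulis \<open>X\<close> or
  \<open>Z\<close> it is an allowed coupling.\<close>

lemma kron_on_qubit:
  assumes "P \<in> carrier_mat 2 2" "Q \<in> carrier_mat 2 2" "i < m"
  shows "kron (on_qubit m P i) Q = on_qubit (m + 1) P i * on_qubit (m + 1) Q m"
  unfolding on_qubit_Suc[OF assms(3)] on_qubit_last
    kron_mult[OF on_qubit_carrier[OF assms(1,3)] one_carrier_mat one_carrier_mat assms(2)]
  using assms on_qubit_carrier[OF assms(1,3)] by simp

lemma zzxx_form_kron_Z:
  assumes "i < m"
  shows "zzxx_form (m + 1) (kron (Z_on m i) pauliZ)"
  using assms zzxx_form_ZZ[of i m "m + 1"] by (subst kron_on_qubit) auto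

lemma zzxx_form_kron_X:
  assumes "i < m"
  shows "zzxx_form (m + 1) (kron (X_on m i) pauliX)"
  using assms zzxx_form_XX[of i m "m + 1"] by (subst kron_on_qubit) auto

lemma zzxx_form_kron_one_Z: "zzxx_form (m + 1) (kron (1\<^sub>m (2 ^ m)) pauliZ)"
  using zzxx_form_Z[of m "m + 1"] unfolding on_qubit_last by simp

lemma on_qubit_Z_square:
  assumes "i < m"
  shows "Z_on m i * Z_on m i = 1\<^sub>m (2 ^ m)"
proof -
  have ZZ: "pauliZ * pauliZ = 1\<^sub>m 2"
    by (rule eq_matI) (auto simp: pauliZ_def mat_of_rows_list_def scalar_prod_def numeral_2_eq_2 less_Suc_eq)
  obtain k where "m = i + Suc k" using assms less_imp_Suc_add by force
  then have m: "(2::nat) ^ i * 2 * 2 ^ (m - 1 - i) = 2 ^ m" by (simp add: power_add)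
  note o = one_carrier_mat
  have k: "kron (1\<^sub>m (2 ^ i)) pauliZ \<in> carrier_mat (2 ^ i * 2) (2 ^ i * 2)"
    by (intro kron_carrier o pauli_carrier)
  show ?thesis
    unfolding on_qubit_def kron_mult[OF k o k o] kron_mult[OF o pauli_carrier(3) o pauli_carrier(3)]
      ZZ left_mult_one_mat[OF o] kron_one_one m ..
qed

text \<open>\<open>Z\<close> is Hermitian with square 1, so it preserves norms; expanding the
  nonnegative square norm of \<open>Z v + v\<close> gives the bound.\<close>

lemma rip_Z_ge:
  assumes "i < m" "v \<in> carrier_vec (2 ^ m)"
  shows "- rip v v \<le> rip (Z_on m i *\<^sub>v v) v"
proof -
  note Z = on_qubit_carrier[OF pauli_carrier(3) assms(1)]
  let ?w = "Z_on m i *\<^sub>v v"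
  have w: "?w \<in> carrier_vec (2 ^ m)" using mult_mat_vec_carrier[OF Z assms(2)] .
  have "rip ?w ?w = rip v v"
    unfolding rip_hermitian[OF Z hermitian_on_qubit[OF hermitian_pauli(3)] assms(2) w]
      assoc_mult_mat_vec[OF Z Z assms(2), symmetric] on_qubit_Z_square[OF assms(1)]
    using assms(2) by simp
  moreover have "0 \<le> rip (?w + v) (?w + v)" by (rule rip_nonneg)
  moreover have "rip v ?w = rip ?w v" by (rule rip_commute[OF assms(2) w])
  ultimately show ?thesis
    using assms(2) w by (simp add: rip_add_left[of _ "2 ^ m"] rip_add_right[of _ "2 ^ m"])
qed

section \<open>The gadget for a YY interaction\<close>

lemma less_4_cases: "(i :: nat) < 4 \<Longrightarrow> i = 0 \<or> i = 1 \<or> i = 2 \<or> i = 3"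
  by linarith

lemma mat4_eqI:
  assumes "A \<in> carrier_mat 4 4" "B \<in> carrier_mat 4 4"
    and "\<And>i j. i \<in> {0, 1, 2, 3} \<Longrightarrow> j \<in> {0, 1, 2, 3} \<Longrightarrow> A $$ (i, j) = B $$ (i, j)"
  shows "A = (B :: complex mat)"
  using assms less_4_cases by (intro eq_matI) auto

lemma pauli_dim [simp]:
  "dim_row pauliX = 2" "dim_col pauliX = 2" "dim_row pauliY = 2" "dim_col pauliY = 2"
  "dim_row pauliZ = 2" "dim_col pauliZ = 2"
  using pauli_carrier[THEN carrier_matD(1)] pauli_carrier[THEN carrier_matD(2)] by auto

lemma kron_2_2_index:
  assumes "P \<in> carrier_mat 2 2" "Q \<in> carrier_mat 2 2" "i < 4" "j < 4"
  shows "kron P Q $$ (i, j) = P $$ (i div 2, j div 2) * Q $$ (i mod 2, j mod 2)"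
  using assms by (subst kron_index) auto

lemma kron_2_2_carrier [simp]:
  assumes "P \<in> carrier_mat 2 2" "Q \<in> carrier_mat 2 2"
  shows "kron P Q \<in> carrier_mat 4 4"
  using kron_carrier[OF assms] by simp

text \<open>The following \<open>4 \<times> 4\<close> matrices act on the first two qubits; the diagonal \<open>2/3, 1, 1, 2\<close> in
  \<open>response\<close> is the inverse of \<open>slack_energy\<close>.\<close>

definition slack_energy :: "complex mat" where
  "slack_energy = mat 4 4 (\<lambda>(i, j). if i = j then [3/2, 1, 1, 1/2] ! i else 0)"

definition coupling :: "real \<Rightarrow> real \<Rightarrow> complex mat" where
  "coupling r t = complex_of_real r \<cdot>\<^sub>m kron pauliX (1\<^sub>m 2) + complex_of_real t \<cdot>\<^sub>m kron (1\<^sub>m 2) pauliX"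

definition response :: "real \<Rightarrow> real \<Rightarrow> complex mat" where
  "response r t = mat 4 4 (\<lambda>(i, j). [2/3, 1, 1, 2] ! i * coupling r t $$ (i, j))"

lemma block_carrier [simp]:
  "slack_energy \<in> carrier_mat 4 4" "coupling r t \<in> carrier_mat 4 4" "response r t \<in> carrier_mat 4 4"
  by (simp_all add: slack_energy_def coupling_def response_def)

lemma slack_energy_eq:
  "slack_energy = 1\<^sub>m 4 + complex_of_real (1/4) \<cdot>\<^sub>m kron pauliZ (1\<^sub>m 2) + complex_of_real (1/4) \<cdot>\<^sub>m kron (1\<^sub>m 2) pauliZ"
  by (rule mat4_eqI) (auto simp: kron_2_2_index slack_energy_def nth_Cons')

lemma coupling_index:
  "i < 4 \<Longrightarrow> j < 4 \<Longrightarrow> coupling r t $$ (i, j) =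
    r * (pauliX $$ (i div 2, j div 2) * 1\<^sub>m 2 $$ (i mod 2, j mod 2)) +
    t * (1\<^sub>m 2 $$ (i div 2, j div 2) * pauliX $$ (i mod 2, j mod 2))"
  by (simp add: coupling_def kron_2_2_index)

lemma lessThan_4: "{..<4 :: nat} = {0, 1, 2, 3}"
  by auto

lemma slack_energy_response: "slack_energy * response r t = coupling r t"
proof (rule mat4_eqI)
  fix i j :: nat assume ij: "i \<in> {0, 1, 2, 3}" "j \<in> {0, 1, 2, 3}"
  then have "i < 4" "j < 4" by auto
  then have "(slack_energy * response r t) $$ (i, j) = (\<Sum>k<4. slack_energy $$ (i, k) * response r t $$ (k, j))"
    by (intro mult_mat_index[of _ 4 4 _ 4]) auto
  also have "\<dots> = coupling r t $$ (i, j)"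
    using ij unfolding lessThan_4 by (auto simp: slack_energy_def response_def nth_Cons')
  finally show "(slack_energy * response r t) $$ (i, j) = coupling r t $$ (i, j)" .
qed (use mult_carrier_mat[OF block_carrier(1) block_carrier(3)] in auto)

text \<open>The inverse of \<open>slack_energy\<close> is 7/6 - (Z_0 + Z_1)/3 + Z_0 Z_1 / 6. Between
  the two couplings the constant yields the identity and X_0 X_1, the single Z terms cancel because
  r and t have equal squares, and Z_0 Z_1 yields Z_0 Z_1 and Y_0 Y_1. The value of
  \<open>r * t\<close> fixes the coefficient of Y_0 Y_1 to be -\<alpha>.\<close>

lemma coupling_response:
  assumes "r * r = 3 * \<bar>\<alpha>\<bar>" "t * t = 3 * \<bar>\<alpha>\<bar>" "r * t = - 3 * \<alpha>"
  shows "coupling r t * response r t = complex_of_real (7 * \<bar>\<alpha>\<bar>) \<cdot>\<^sub>m 1\<^sub>m 4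
    + complex_of_real (- 7 * \<alpha>) \<cdot>\<^sub>m kron pauliX pauliX + complex_of_real (- \<bar>\<alpha>\<bar>) \<cdot>\<^sub>m kron pauliZ pauliZ
    + complex_of_real (- \<alpha>) \<cdot>\<^sub>m kron pauliY pauliY"
    (is "_ = ?R")
proof (rule mat4_eqI)
  have c: "complex_of_real r * complex_of_real r = 3 * complex_of_real \<bar>\<alpha>\<bar>"
    "complex_of_real t * complex_of_real t = 3 * complex_of_real \<bar>\<alpha>\<bar>"
    "complex_of_real r * complex_of_real t = - 3 * complex_of_real \<alpha>"
    "complex_of_real t * complex_of_real r = - 3 * complex_of_real \<alpha>"
    using assms[THEN arg_cong[of _ _ complex_of_real]] by (simp_all add: mult.commute)
  fix i j :: nat assume ij: "i \<in> {0, 1, 2, 3}" "j \<in> {0, 1, 2, 3}"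
  then have "i < 4" "j < 4" by auto
  then have "(coupling r t * response r t) $$ (i, j) = (\<Sum>k<4. coupling r t $$ (i, k) * response r t $$ (k, j))"
    by (intro mult_mat_index[of _ 4 4 _ 4]) auto
  also have "\<dots> = ?R $$ (i, j)"
    using ij unfolding lessThan_4
    by (auto simp: response_def coupling_index kron_2_2_index nth_Cons' c mult.left_commute[of _ 2])
  finally show "(coupling r t * response r t) $$ (i, j) = ?R $$ (i, j)" .
qed (use mult_carrier_mat[OF block_carrier(2) block_carrier(3)] in auto)

text \<open>The block gadget with \<open>D\<close>, \<open>R\<close> and \<open>G\<close> acting on
  the first two qubits. The scale \<open>l\<close> stays free above the threshold, so that the
  penalty can be chosen afterwards.\<close>

lemma yy_gadget:
  assumes n: "n \<ge> 2" and H: "zzxx_form n H_else"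
    and T: "T = H_else + complex_of_real \<alpha> \<cdot>\<^sub>m (Y_on n 0 * Y_on n 1)"
  shows "\<exists>C>0. \<forall>\<epsilon> l. 0 < \<epsilon> \<longrightarrow> \<epsilon> \<le> 1 \<longrightarrow> 0 < l \<longrightarrow> C / \<epsilon> \<le> l\<^sup>2 \<longrightarrow>
    (\<exists>G. zzxx_form (n + 1) G \<and> (\<forall>j\<in>{1..2 ^ n}. \<bar>nth_eigenvalue j G - nth_eigenvalue j T\<bar> \<le> \<epsilon>))"
proof -
  define r where "r = sqrt (3 * \<bar>\<alpha>\<bar>)"
  \<comment> \<open>The sign of \<open>t\<close> is opposite to that of \<alpha>, so that
    \<open>r * t\<close> is -3 \<alpha> while the squares stay equal.\<close>
  define t where "t = (if \<alpha> > 0 then - r else r)"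
  have rt: "r * r = 3 * \<bar>\<alpha>\<bar>" "t * t = 3 * \<bar>\<alpha>\<bar>" "r * t = - 3 * \<alpha>"
    by (auto simp: t_def r_def)
  let ?N = "2 ^ (n - 2) :: nat" and ?d = "2 ^ n :: nat"
  have dN: "?d = 4 * ?N"
  proof -
    have "n = 2 + (n - 2)" using n by simp
    then have "?d = 2 ^ (2 + (n - 2))" by (rule arg_cong)
    then show ?thesis unfolding power_add by simp
  qed
  \<comment> \<open>Extension from the first two qubits to the register by the identity; it is
    multiplicative, which reduces the operator identities to four by four matrices.\<close>
  let ?B = "\<lambda>Q. kron Q (1\<^sub>m ?N)"
  have B: "?B Q \<in> carrier_mat ?d ?d" if "Q \<in> carrier_mat 4 4" for Q
    unfolding dN using that by (intro kron_carrier) auto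
  have B_mult: "?B P * ?B Q = ?B (P * Q)" if "P \<in> carrier_mat 4 4" "Q \<in> carrier_mat 4 4" for P Q
    using kron_mult[OF that(1) one_carrier_mat that(2) one_carrier_mat] by simp
  have q0: "on_qubit n P 0 = ?B (kron P (1\<^sub>m 2))" for P using on_qubit_0[OF n] .
  have q1: "on_qubit n P 1 = ?B (kron (1\<^sub>m 2) P)" for P by (rule on_qubit_1)
  have q01: "on_qubit n P 0 * on_qubit n P 1 = ?B (kron P P)" if P: "P \<in> carrier_mat 2 2" for P
    unfolding q0 q1 using P
    by (simp add: B_mult kron_mult[OF P one_carrier_mat one_carrier_mat P])
  define D where "D = ?B slack_energy"
  define R where "R = ?B (coupling r t)"
  define G where "G = ?B (response r t)"
  define Y where "Y = Y_on n 0 * Y_on n 1"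
  have D: "D \<in> carrier_mat ?d ?d" and R: "R \<in> carrier_mat ?d ?d" and G: "G \<in> carrier_mat ?d ?d"
    unfolding D_def R_def G_def by (intro B block_carrier)+
  have q: "on_qubit n P i \<in> carrier_mat ?d ?d" if "P \<in> carrier_mat 2 2" "i < 2" for P i
    using that n by (intro on_qubit_carrier) auto
  have D_eq: "D = 1\<^sub>m ?d + complex_of_real (1/4) \<cdot>\<^sub>m Z_on n 0 + complex_of_real (1/4) \<cdot>\<^sub>m Z_on n 1"
    unfolding D_def slack_energy_eq q0 q1
    by (simp add: kron_add_left[of _ 4 4] kron_smult_left kron_one_one dN)
  have R_eq: "R = complex_of_real r \<cdot>\<^sub>m X_on n 0 + complex_of_real t \<cdot>\<^sub>m X_on n 1"
    unfolding R_def coupling_def q0 q1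
    by (simp add: kron_add_left[of _ 4 4] kron_smult_left)
  have Y: "Y = ?B (kron pauliY pauliY)" "Y \<in> carrier_mat ?d ?d"
    unfolding Y_def q01[OF pauli_carrier(2)] using B[OF kron_2_2_carrier[OF pauli_carrier(2) pauli_carrier(2)]] by auto
  have DG: "D * G = R"
    unfolding D_def G_def R_def by (simp add: B_mult slack_energy_response)
  \<comment> \<open>The part of \<open>R * G\<close> that has ZZXX form; what remains is the YY term
    with coefficient -\<alpha>.\<close>
  define K where "K = complex_of_real (7 * \<bar>\<alpha>\<bar>) \<cdot>\<^sub>m 1\<^sub>m ?d
    + complex_of_real (- 7 * \<alpha>) \<cdot>\<^sub>m (X_on n 0 * X_on n 1) + complex_of_real (- \<bar>\<alpha>\<bar>) \<cdot>\<^sub>m (Z_on n 0 * Z_on n 1)"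
  have zK: "zzxx_form n K"
    unfolding K_def using n by (intro zzxx_form_add zzxx_form_smult zzxx_form_one zzxx_form_XX zzxx_form_ZZ) auto
  have RG: "R * G = K + complex_of_real (- \<alpha>) \<cdot>\<^sub>m Y"
    unfolding R_def G_def B_mult[OF block_carrier(2,3)] coupling_response[OF rt] K_def Y(1)
      q01[OF pauli_carrier(1)] q01[OF pauli_carrier(3)]
    by (simp add: kron_add_left[of _ 4 4] kron_smult_left kron_one_one dN del: of_real_minus)
  note Hc = zzxx_form_carrier[OF H] and Kc = zzxx_form_carrier[OF zK]
  define A where "A = T + R * G"
  \<comment> \<open>The YY term of \<open>R * G\<close> cancels the one in \<open>T\<close>.\<close>
  have A_eq: "A = H_else + K"
    unfolding A_def RG T Y_def[symmetric] using Hc Kc Y(2) by (intro eq_matI) auto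
  have zA: "zzxx_form n A" unfolding A_eq using H zK by (rule zzxx_form_add)
  have hY: "hermitian_mat Y"
    unfolding Y(1) by (intro hermitian_kron hermitian_pauli hermitian_one)
  have T': "T \<in> carrier_mat ?d ?d" "hermitian_mat T"
    unfolding T Y_def[symmetric] using Hc Y(2) hY zzxx_form_hermitian[OF H]
    by (auto intro!: hermitian_add hermitian_smult)
  have zD: "zzxx_form n D"
    unfolding D_eq using n by (intro zzxx_form_add zzxx_form_smult zzxx_form_one zzxx_form_Z) auto
  have zR: "zzxx_form n R"
    unfolding R_eq using n by (intro zzxx_form_add zzxx_form_smult zzxx_form_X) auto
  \<comment> \<open>Each of the two \<open>Z\<close> terms lowers the identity by at most 1/4, which
    leaves 1/2.\<close>
  have coercive: "1/2 * rip v v \<le> rip (D *\<^sub>v v) v" if v: "v \<in> carrier_vec ?d" for v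
  proof -
    have z: "Z_on n 0 *\<^sub>v v \<in> carrier_vec ?d" "Z_on n 1 *\<^sub>v v \<in> carrier_vec ?d"
      using mult_mat_vec_carrier[OF q v] by auto
    have "D *\<^sub>v v = v + complex_of_real (1/4) \<cdot>\<^sub>v (Z_on n 0 *\<^sub>v v) + complex_of_real (1/4) \<cdot>\<^sub>v (Z_on n 1 *\<^sub>v v)"
      unfolding D_eq using q[OF pauli_carrier(3), of 0] q[OF pauli_carrier(3), of 1] v
      by (simp add: add_mult_distrib_mat_vec[of _ ?d ?d] smult_mat_mult_vec[of _ ?d ?d] del: One_nat_def)
    then have "rip (D *\<^sub>v v) v = rip v v + 1/4 * rip (Z_on n 0 *\<^sub>v v) v + 1/4 * rip (Z_on n 1 *\<^sub>v v) v"
      using v z by (simp only: rip_add_left[of _ ?d] rip_smult_left[of _ ?d] add_carrier_vec smult_carrier_vec)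
    then show ?thesis using rip_Z_ge[of 0 n v] rip_Z_ge[of 1 n v] v n by simp
  qed
  have zG: "zzxx_form (n + 1) (gadget l A D R)" for l
  proof -
    \<comment> \<open>Writing the projector as (1 - Z)/2 turns the slack energy into
      \<open>D\<close> itself and \<open>D\<close> times a slack \<open>Z\<close>. As
      \<open>D\<close> has only identity and single \<open>Z\<close> terms, nothing beyond ZZ
      arises; likewise \<open>R\<close> times a slack \<open>X\<close> is a sum of XX terms.\<close>
    have k: "ketbra1 = complex_of_real (1/2) \<cdot>\<^sub>m 1\<^sub>m 2 + complex_of_real (- 1/2) \<cdot>\<^sub>m pauliZ"
      by (rule eq_matI) (auto simp: less_2_cases_iff, auto simp: ketbra1_def mat_of_rows_list_def)
    have DZ: "kron D pauliZ = kron (1\<^sub>m ?d) pauliZ + complex_of_real (1/4) \<cdot>\<^sub>m kron (Z_on n 0) pauliZ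
        + complex_of_real (1/4) \<cdot>\<^sub>m kron (Z_on n 1) pauliZ"
      unfolding D_eq using q[OF pauli_carrier(3), of 0] q[OF pauli_carrier(3), of 1]
      by (simp add: kron_add_left[of _ ?d ?d] kron_smult_left del: One_nat_def)
    have RX: "kron R pauliX = complex_of_real r \<cdot>\<^sub>m kron (X_on n 0) pauliX + complex_of_real t \<cdot>\<^sub>m kron (X_on n 1) pauliX"
      unfolding R_eq using q[OF pauli_carrier(1), of 0] q[OF pauli_carrier(1), of 1]
      by (simp add: kron_add_left[of _ ?d ?d] kron_smult_left del: One_nat_def)
    have Dk: "kron D ketbra1 = complex_of_real (1/2) \<cdot>\<^sub>m kron D (1\<^sub>m 2) + complex_of_real (- 1/2) \<cdot>\<^sub>m kron D pauliZ"
      unfolding k by (simp add: kron_add_right[of _ 2 2] kron_smult_right)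
    show ?thesis
      unfolding gadget_def Dk DZ RX using n
      by (intro zzxx_form_add zzxx_form_smult zzxx_form_kron_one zzxx_form_kron_Z zzxx_form_kron_X
          zzxx_form_kron_one_Z zD zA) auto
  qed
  obtain C where C: "C > 0"
    and bound: "\<And>\<epsilon> l j. 0 < \<epsilon> \<Longrightarrow> \<epsilon> \<le> 1 \<Longrightarrow> 0 < l \<Longrightarrow> C / \<epsilon> \<le> l\<^sup>2 \<Longrightarrow> j \<in> {1..?d} \<Longrightarrow>
      \<bar>nth_eigenvalue j (gadget l A D R) - nth_eigenvalue j T\<bar> \<le> \<epsilon>"
    using gadget_eigenvalues[OF T' D zzxx_form_hermitian[OF zD] R zzxx_form_hermitian[OF zR] G DG A_def
        zzxx_form_hermitian[OF zA] zzxx_form_hermitian[OF zG] _ coercive] by auto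
  then show ?thesis using zG by blast
qed

section \<open>Choice of the penalty and of the remaining operator\<close>

theorem theorem13:
  fixes n :: nat and \<alpha> :: real and H_else H_targ :: "complex mat"
  assumes "n \<ge> 2"
    and "zzxx_form n H_else"
    and "H_targ = H_else + complex_of_real \<alpha> \<cdot>\<^sub>m (Y_on n 0 * Y_on n 1)"
  shows "\<exists>\<epsilon>\<^sub>0 C :: real. \<epsilon>\<^sub>0 > 0 \<and> C > 0 \<and>
    (\<forall>\<epsilon> :: real. 0 < \<epsilon> \<and> \<epsilon> \<le> \<epsilon>\<^sub>0 \<longrightarrow>
      (\<exists>(\<Delta> :: real) (V :: complex mat) (H_gad :: complex mat).
         0 < \<Delta> \<and> \<Delta> \<le> C * \<epsilon> powi (-4) \<and>
         V \<in> carrier_mat (2 ^ (n + 1)) (2 ^ (n + 1)) \<and> hermitian_mat V \<and>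
         H_gad = complex_of_real \<Delta> \<cdot>\<^sub>m on_qubit (n + 1) ketbra1 n + V \<and>
         zzxx_form (n + 1) H_gad \<and>
         (\<forall>j\<in>{1..2 ^ n}. \<bar>nth_eigenvalue j H_gad - nth_eigenvalue j H_targ\<bar> \<le> \<epsilon>)))"
proof -
  obtain C where C: "C > 0"
    and gad: "\<And>\<epsilon> l. 0 < \<epsilon> \<Longrightarrow> \<epsilon> \<le> 1 \<Longrightarrow> 0 < l \<Longrightarrow> C / \<epsilon> \<le> l\<^sup>2 \<Longrightarrow>
      \<exists>G. zzxx_form (n + 1) G \<and> (\<forall>j\<in>{1..2 ^ n}. \<bar>nth_eigenvalue j G - nth_eigenvalue j H_targ\<bar> \<le> \<epsilon>)"
    using yy_gadget[OF assms] by blast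
  show ?thesis
  proof (rule exI[of _ 1], rule exI[of _ C], intro conjI allI impI)
    fix \<epsilon> :: real assume \<epsilon>: "0 < \<epsilon> \<and> \<epsilon> \<le> 1"
    \<comment> \<open>The smallest penalty allowed by the threshold; the gadget scale is its square
      root.\<close>
    let ?\<Delta> = "C / \<epsilon>" and ?P = "on_qubit (n + 1) ketbra1 n" and ?e = "2 ^ (n + 1) :: nat"
    have \<Delta>: "?\<Delta> > 0" using C \<epsilon> by simp
    then obtain G where G: "zzxx_form (n + 1) G"
      and ev: "\<forall>j\<in>{1..2 ^ n}. \<bar>nth_eigenvalue j G - nth_eigenvalue j H_targ\<bar> \<le> \<epsilon>"
      using gad[of \<epsilon> "sqrt ?\<Delta>"] \<epsilon> by auto
    have P: "?P \<in> carrier_mat ?e ?e" "hermitian_mat ?P"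
      by (intro on_qubit_carrier pauli_carrier) (auto intro: hermitian_on_qubit hermitian_pauli)
    note Gc = zzxx_form_carrier[OF G]
    \<comment> \<open>What remains of the gadget once the bare penalty is removed, so the prescribed
      decomposition holds by construction.\<close>
    define V where "V = G + complex_of_real (- ?\<Delta>) \<cdot>\<^sub>m ?P"
    have "?\<Delta> \<le> C * \<epsilon> powi (-4)"
    proof -
      \<comment> \<open>For \<epsilon> at most 1, a penalty of order 1/\<epsilon> lies within the
        allowed order of the inverse fourth power.\<close>
      have "\<epsilon> ^ 4 \<le> \<epsilon> ^ 1" using \<epsilon> by (intro power_decreasing) auto
      then have "1 / \<epsilon> \<le> 1 / \<epsilon> ^ 4" using \<epsilon> by (intro divide_left_mono) auto
      then show ?thesis
        using mult_left_mono[of "1 / \<epsilon>" "1 / \<epsilon> ^ 4" C] C by (simp add: power_int_minus divide_inverse)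
    qed
    moreover have "V \<in> carrier_mat ?e ?e" using Gc P by (simp add: V_def)
    moreover have "hermitian_mat V"
      unfolding V_def using Gc P zzxx_form_hermitian[OF G]
      by (intro hermitian_add[of _ ?e] hermitian_smult) auto
    moreover have "G = complex_of_real ?\<Delta> \<cdot>\<^sub>m ?P + V"
      using Gc P by (intro eq_matI) (auto simp: V_def)
    ultimately show "\<exists>\<Delta> V H_gad. 0 < \<Delta> \<and> \<Delta> \<le> C * \<epsilon> powi (-4) \<and>
         V \<in> carrier_mat (2 ^ (n + 1)) (2 ^ (n + 1)) \<and> hermitian_mat V \<and>
         H_gad = complex_of_real \<Delta> \<cdot>\<^sub>m ?P + V \<and> zzxx_form (n + 1) H_gad \<and>
         (\<forall>j\<in>{1..2 ^ n}. \<bar>nth_eigenvalue j H_gad - nth_eigenvalue j H_targ\<bar> \<le> \<epsilon>)"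
      using \<Delta> G ev by blast
  qed (use C in auto)
qed

end
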